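(* Let $n\ge 2$ and let $\alpha_1\ge\alpha_2\ge\dots\ge\alpha_n>0$ be ordinals, and $X=\omega^{\alpha_1}\times\dots\times\omega^{\alpha_n}$. Then $\mathbf{w}(X)=\omega^{\eta}$ with $\eta=\alpha_1\oplus\bigl((\alpha_2\oplus\dots\oplus\alpha_n)-1\bigr)$. Explicitly: if all $\alpha_i$ are finite then $\eta=\alpha_1+\dots+\alpha_n-1$; if $\alpha_1$ is infinite and $\alpha_2,\dots,\alpha_n$ are finite then $\eta=\alpha_1+(\alpha_2+\dots+\alpha_n-1)$; if at least two of the $\alpha_i$ are infinite then $\eta=\alpha_1\oplus\dots\oplus\alpha_n$.
   Context: Ordinals are well-orders; $X$ has the componentwise order. The width $\mathbf{w}(A)$ of a wqo $A$ is the rank of the forest of nonempty finite sequences of pairwise incomparable elements of $A$ ordered by initial segment ($\mathbf{w}(A)=\sup_s(r(s)+1)$, $r(s)=\sup\{r(t)+1:t$ child of $s\}$). $\oplus$ is the natural (Hessenberg) sum. For ordinals $\beta\le\gamma$, $\gamma-\beta$ denotes the unique ordinal $\delta$ with $\beta+\delta=\gamma$ (left subtraction); in particular $\gamma-1=\gamma$ for infinite $\gamma$ and $\gamma-1$ is the predecessor for finite $\gamma\ge 1$. *)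

theory Defs
  imports Main
begin

text \<open>Ordinals are represented by well-order relations (Well_order), compared up to
  order type with the library relations ordIso, ordLeq (=o, \<le>o).\<close>

text \<open>R is a "child-of" relation: (y, x) \<in> R means y is a child (immediate successor
  below) of x.  The rank is rk(x) = sup {rk(y) + 1 : (y, x) \<in> R}.
  rank_le R x W: rk(x) \<le> ot(W);  rank_ge R x W: rk(x) \<ge> ot(W),
  where ordinals below ot(W) are the order types of the initial segments
  Restr W (underS W w), w \<in> Field W.\<close>

inductive rank_le :: "('n \<times> 'n) set \<Rightarrow> 'n \<Rightarrow> 'b rel \<Rightarrow> bool" for R where
  "(\<forall>y. (y, x) \<in> R \<longrightarrow> (\<exists>w \<in> Field W. rank_le R y (Restr W (underS W w))))
     \<Longrightarrow> rank_le R x W"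

inductive rank_ge :: "('n \<times> 'n) set \<Rightarrow> 'n \<Rightarrow> 'b rel \<Rightarrow> bool" for R where
  "(\<forall>w \<in> Field W. \<exists>y. (y, x) \<in> R \<and> rank_ge R y (Restr W (underS W w)))
     \<Longrightarrow> rank_ge R x W"

definition rank_is :: "('n \<times> 'n) set \<Rightarrow> 'n \<Rightarrow> 'b rel \<Rightarrow> bool" where
  "rank_is R x W \<longleftrightarrow> Well_order W \<and> rank_le R x W \<and> rank_ge R x W"

definition antichain_seqs :: "'x set \<Rightarrow> ('x \<Rightarrow> 'x \<Rightarrow> bool) \<Rightarrow> 'x list set" where
  "antichain_seqs A le = {s. set s \<subseteq> A \<and>
     (\<forall>i < length s. \<forall>j < length s. i \<noteq> j \<longrightarrow> \<not> le (s ! i) (s ! j))}"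

definition antichain_tree :: "'x set \<Rightarrow> ('x \<Rightarrow> 'x \<Rightarrow> bool) \<Rightarrow> ('x list \<times> 'x list) set" where
  "antichain_tree A le = {(s @ [x], s) | s x. s @ [x] \<in> antichain_seqs A le}"

text \<open>w(A) = sup over nonempty s of (r(s)+1) = rank of the added root [].\<close>
definition width_is :: "'x set \<Rightarrow> ('x \<Rightarrow> 'x \<Rightarrow> bool) \<Rightarrow> 'b rel \<Rightarrow> bool" where
  "width_is A le W \<longleftrightarrow> rank_is (antichain_tree A le) [] W"

text \<open>omega^alpha as finitely supported functions alpha \<Rightarrow> nat, ordered by the value at
  the largest position where they differ (Cantor normal form order).\<close>
definition opow_carrier :: "'a rel \<Rightarrow> ('a \<Rightarrow> nat) set" where
  "opow_carrier r = {f. finite {x. f x \<noteq> 0} \<and> (\<forall>x. f x \<noteq> 0 \<longrightarrow> x \<in> Field r)}"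

definition omega_pow :: "'a rel \<Rightarrow> ('a \<Rightarrow> nat) rel" where
  "omega_pow r = {(f, g). f \<in> opow_carrier r \<and> g \<in> opow_carrier r \<and>
     (f = g \<or> (\<exists>x. f x < g x \<and> (\<forall>y. (x, y) \<in> r \<and> y \<noteq> x \<longrightarrow> f y = g y)))}"

text \<open>Ordinals \<le> ot(A) are represented in 'a option: Some a is the ordinal of the
  initial segment below a, None is ot(A) itself.\<close>
definition le_opt :: "'a rel \<Rightarrow> 'a option \<Rightarrow> 'a option \<Rightarrow> bool" where
  "le_opt A u v \<longleftrightarrow> (u = None \<longrightarrow> v = None) \<and>
     (\<forall>a. u = Some a \<longrightarrow> a \<in> Field A \<and> (v = None \<or> (\<exists>b. v = Some b \<and> (a, b) \<in> A)))"

text \<open>The natural sum of ordinals is characterised recursively: a1 \<oplus> ... \<oplus> ak is the least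
  ordinal exceeding every natural sum obtained by decreasing one (hence at least one)
  argument; i.e. it is the rank of the top tuple in the componentwise strict order on
  the product of the (alpha_i + 1).\<close>
definition natsum_rel :: "(nat \<Rightarrow> 'a rel) \<Rightarrow> nat set \<Rightarrow> ((nat \<Rightarrow> 'a option) \<times> (nat \<Rightarrow> 'a option)) set" where
  "natsum_rel r I = {(u, v). (\<forall>i. i \<notin> I \<longrightarrow> u i = None \<and> v i = None) \<and> u \<noteq> v \<and>
     (\<forall>i \<in> I. le_opt (r i) (u i) (v i) \<and> le_opt (r i) (v i) None)}"

definition natsum_is :: "(nat \<Rightarrow> 'a rel) \<Rightarrow> nat set \<Rightarrow> 'b rel \<Rightarrow> bool" where
  "natsum_is r I W \<longleftrightarrow> rank_is (natsum_rel r I) (\<lambda>_. None) W"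

definition natsum2_rel :: "'a rel \<Rightarrow> 'b rel \<Rightarrow> (('a option \<times> 'b option) \<times> ('a option \<times> 'b option)) set" where
  "natsum2_rel A B = {((u1, u2), (v1, v2)). (u1, u2) \<noteq> (v1, v2) \<and>
     le_opt A u1 v1 \<and> le_opt A v1 None \<and> le_opt B u2 v2 \<and> le_opt B v2 None}"

definition natsum2_is :: "'a rel \<Rightarrow> 'b rel \<Rightarrow> 'c rel \<Rightarrow> bool" where
  "natsum2_is A B W \<longleftrightarrow> rank_is (natsum2_rel A B) (None, None) W"

section \<open>1 + delta (for left subtraction gamma - 1)\<close>

definition one_plus :: "'a rel \<Rightarrow> 'a option rel" where
  "one_plus D = {(None, None)} \<union> {(None, Some b) | b. b \<in> Field D} \<union>
     {(Some a, Some b) | a b. (a, b) \<in> D}"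

definition prod_X :: "nat \<Rightarrow> (nat \<Rightarrow> 'a rel) \<Rightarrow> (nat \<Rightarrow> 'a \<Rightarrow> nat) set" where
  "prod_X n r = {x. (\<forall>i < n. x i \<in> Field (omega_pow (r i))) \<and> (\<forall>i \<ge> n. x i = (\<lambda>_. 0))}"

definition prod_le :: "nat \<Rightarrow> (nat \<Rightarrow> 'a rel) \<Rightarrow> (nat \<Rightarrow> 'a \<Rightarrow> nat) \<Rightarrow> (nat \<Rightarrow> 'a \<Rightarrow> nat) \<Rightarrow> bool" where
  "prod_le n r x y \<longleftrightarrow> (\<forall>i < n. (x i, y i) \<in> omega_pow (r i))"

end

theory Submission
  imports Defs "HOL-Library.Multiset"
begin

text \<open>The width of a wqo is the rank of passing from \<open>Y\<close> to the elements of \<open>Y\<close> incomparable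
  to some \<open>x \<in> Y\<close>.  For \<open>X = \<omega>^\<alpha>\<^sub>1 \<times> \<dots> \<times> \<omega>^\<alpha>\<^sub>n\<close> such a residual is covered by finitely many copies of
  products in which a single \<open>\<alpha>\<^sub>i\<close> has been decreased, provided another \<open>\<alpha>\<^sub>j\<close> is nonzero, and
  the width of a finite union is bounded by the natural sum of the widths.  Conversely, if
  \<open>\<beta> < \<alpha>\<^sub>i\<close>, then any number of copies of the product with \<open>\<alpha>\<^sub>i\<close> replaced by \<open>\<beta>\<close> can be
  played one after the other, downwards in coordinate \<open>i\<close>, shifting each new copy upwards in
  coordinate \<open>j\<close> past everything played before.  Hence the width is \<open>\<omega>\<close> to the power of the
  rank of \<open>(\<alpha>\<^sub>1, \<dots>, \<alpha>\<^sub>n)\<close> under decreasing one entry while another one is nonzero, and this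
  rank is computed by comparison with the natural sum.\<close>

text \<open>The two bounds use different sums: covers give natural sums, plays in succession only
  ordinary multiples \<omega>^p \<cdot> k. They still meet, since \<omega>^e is closed under natural
  sums and, for e > 0, the multiples with p < e are cofinal in it. The unit lost in the exponent
  comes from the end of a play: a tuple with a single nonzero entry stands for a chain, so it has
  rank 0 however large that entry is. If all entries but the first are finite, this costs exactly
  one unit of the natural sum. If two entries are infinite, the unit is won back: before an infinite
  entry drops to a finite value, an extra move to a value in between can be inserted. Left
  subtraction from the sum of the tail describes both cases at once. The sums enter only as
  well-orders characterised by ranks, so exponents too are compared by letting one play simulate
  another.\<close>

section \<open>Ranks measured along the initial segments of a well-order\<close>

definition below :: "'a rel \<Rightarrow> 'a option \<Rightarrow> 'a set" where
  "below W e = (case e of None \<Rightarrow> Field W | Some a \<Rightarrow> underS W a)"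

text \<open>The coding of \<open>le_opt\<close>: \<open>Some a\<close> is the ordinal of the segment
  below \<open>a\<close>, and \<open>None\<close> that of \<open>W\<close> itself. Bounds can thus
  range over all ordinals up to and including that of \<open>W\<close>.\<close>

definition iseg :: "'a rel \<Rightarrow> 'a option \<Rightarrow> 'a rel" where
  "iseg W e = Restr W (below W e)"

lemma below_None [simp]: "below W None = Field W"
  and below_Some [simp]: "below W (Some a) = underS W a"
  by (simp_all add: below_def)

lemma below_subset_Field: "below W e \<subseteq> Field W"
  by (cases e) (auto simp: underS_def Field_def)

lemma iseg_None [simp]: "iseg W None = W"
  by (auto simp: iseg_def Field_def)

lemma Well_order_refl: "Well_order W \<Longrightarrow> a \<in> Field W \<Longrightarrow> (a, a) \<in> W"
  by (auto simp: order_on_defs refl_on_def)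

lemma Well_order_trans: "Well_order W \<Longrightarrow> (a, b) \<in> W \<Longrightarrow> (b, c) \<in> W \<Longrightarrow> (a, c) \<in> W"
  unfolding order_on_defs by (meson transD)

lemma Well_order_antisym: "Well_order W \<Longrightarrow> (a, b) \<in> W \<Longrightarrow> (b, a) \<in> W \<Longrightarrow> a = b"
  unfolding order_on_defs by (meson antisymD)

lemma Well_order_total:
  "Well_order W \<Longrightarrow> a \<in> Field W \<Longrightarrow> b \<in> Field W \<Longrightarrow> (a, b) \<in> W \<or> (b, a) \<in> W"
  by (metis Well_order_refl order_on_defs(3) order_on_defs(4) total_on_def
      well_order_on_def linear_order_on_def)

lemma Well_order_wf: "Well_order W \<Longrightarrow> wf (W - Id)"
  by (simp add: well_order_on_def)

lemma below_closed:
  assumes "Well_order W" "v \<in> below W e" "u \<in> underS W v"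
  shows "u \<in> below W e"
proof (cases e)
  case None
  then show ?thesis using assms(3) by (auto simp: underS_def Field_def)
next
  case (Some a)
  then show ?thesis
    using assms Well_order_trans[OF assms(1)] Well_order_antisym[OF assms(1)]
    by (simp add: underS_def) metis
qed

lemma underS_mono: "Well_order W \<Longrightarrow> v \<in> below W e \<Longrightarrow> underS W v \<subseteq> below W e"
  using below_closed by fast

lemma Field_iseg: "Well_order W \<Longrightarrow> Field (iseg W e) = below W e"
  using below_subset_Field[of W e] Well_order_refl[of W]
  by (force simp: iseg_def Field_def)

lemma underS_iseg:
  "Well_order W \<Longrightarrow> v \<in> below W e \<Longrightarrow> underS (iseg W e) v = underS W v"
  using below_closed[of W v e] by (auto simp: iseg_def underS_def)

text \<open>The rank predicates restrict an already restricted relation at every step. These nested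
  restrictions collapse to segments of the one fixed \<open>W\<close>, so a rank argument only has
  to carry an option value.\<close>

lemma Restr_iseg:
  "Well_order W \<Longrightarrow> v \<in> below W e \<Longrightarrow>
    Restr (iseg W e) (underS (iseg W e) v) = iseg W (Some v)"
  using below_closed[of W v e] by (auto simp: underS_iseg) (auto simp: iseg_def)

lemma rank_le_iseg:
  assumes "Well_order W"
  shows "rank_le R x (iseg W e) \<longleftrightarrow>
    (\<forall>y. (y, x) \<in> R \<longrightarrow> (\<exists>w \<in> below W e. rank_le R y (iseg W (Some w))))"
  by (subst rank_le.simps) (auto simp: Field_iseg[OF assms] Restr_iseg[OF assms])

lemma rank_ge_iseg:
  assumes "Well_order W"
  shows "rank_ge R x (iseg W e) \<longleftrightarrow>
    (\<forall>w \<in> below W e. \<exists>y. (y, x) \<in> R \<and> rank_ge R y (iseg W (Some w)))"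
  by (subst rank_ge.simps) (auto simp: Field_iseg[OF assms] Restr_iseg[OF assms])

lemma rank_le_isegD:
  "Well_order W \<Longrightarrow> rank_le R x (iseg W e) \<Longrightarrow> (y, x) \<in> R \<Longrightarrow>
    \<exists>w \<in> below W e. rank_le R y (iseg W (Some w))"
  using rank_le_iseg by fast

lemma rank_ge_isegD:
  "Well_order W \<Longrightarrow> rank_ge R x (iseg W e) \<Longrightarrow> w \<in> below W e \<Longrightarrow>
    \<exists>y. (y, x) \<in> R \<and> rank_ge R y (iseg W (Some w))"
  using rank_ge_iseg by fast

lemma below_induct [consumes 1, case_names below]:
  assumes W: "Well_order W"
    and step: "\<And>e. (\<And>w. w \<in> below W e \<Longrightarrow> Q (Some w)) \<Longrightarrow> Q e"
  shows "Q e"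
proof -
  have "Q (Some w)" for w
    using Well_order_wf[OF W]
  proof (induction w rule: wf_induct_rule)
    case (less w)
    show ?case by (rule step) (auto simp: underS_def intro: less.IH)
  qed
  then show ?thesis by (rule step)
qed

text \<open>With its dual \<open>rank_ge_sim\<close> this is the proof principle for most rank
  bounds below: \<open>P\<close> is an invariant of a play and a simultaneous descent through
  ordinals. For upper bounds the descent answers the play, for lower bounds the play answers the
  descent.\<close>

lemma rank_le_sim:
  assumes W: "Well_order W" and "P x e"
    and step: "\<And>x e y. P x e \<Longrightarrow> (y, x) \<in> R \<Longrightarrow> \<exists>w \<in> below W e. P y (Some w)"
  shows "rank_le R x (iseg W e)"
  using W assms(2)
proof (induction e arbitrary: x rule: below_induct)
  case (below e)
  then show ?case using step by (subst rank_le_iseg[OF W]) blast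
qed

lemma rank_ge_sim:
  assumes W: "Well_order W" and "P x e"
    and step: "\<And>x e w. P x e \<Longrightarrow> w \<in> below W e \<Longrightarrow> \<exists>y. (y, x) \<in> R \<and> P y (Some w)"
  shows "rank_ge R x (iseg W e)"
  using W assms(2)
proof (induction e arbitrary: x rule: below_induct)
  case (below e)
  then show ?case using step by (subst rank_ge_iseg[OF W]) blast
qed

section \<open>Powers of omega\<close>

definition opow_less :: "'a rel \<Rightarrow> ('a \<Rightarrow> nat) \<Rightarrow> ('a \<Rightarrow> nat) \<Rightarrow> bool" where
  "opow_less r f g \<longleftrightarrow> (\<exists>x. f x < g x \<and> (\<forall>y. (x, y) \<in> r \<and> y \<noteq> x \<longrightarrow> f y = g y))"

lemma omega_pow_iff:
  "(f, g) \<in> omega_pow r \<longleftrightarrow>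
    f \<in> opow_carrier r \<and> g \<in> opow_carrier r \<and> (f = g \<or> opow_less r f g)"
  by (auto simp: omega_pow_def opow_less_def)

lemma Field_omega_pow [simp]: "Field (omega_pow r) = opow_carrier r"
  by (auto simp: Field_def omega_pow_iff)

lemma opow_carrier_finite: "f \<in> opow_carrier r \<Longrightarrow> finite {x. f x \<noteq> 0}"
  and opow_carrier_Field: "f \<in> opow_carrier r \<Longrightarrow> f x \<noteq> 0 \<Longrightarrow> x \<in> Field r"
  by (auto simp: opow_carrier_def)

lemma opow_carrier_zero [simp]: "(\<lambda>_. 0) \<in> opow_carrier r"
  by (simp add: opow_carrier_def)

lemma opow_carrier_upd:
  "f \<in> opow_carrier r \<Longrightarrow> x \<in> Field r \<Longrightarrow> f(x := k) \<in> opow_carrier r"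
proof -
  assume a: "f \<in> opow_carrier r" "x \<in> Field r"
  have "{y. (f(x := k)) y \<noteq> 0} \<subseteq> insert x {y. f y \<noteq> 0}" by auto
  then have "finite {y. (f(x := k)) y \<noteq> 0}"
    by (rule finite_subset) (simp add: opow_carrier_finite[OF a(1)] del: neq0_conv)
  then show ?thesis using a by (simp add: opow_carrier_def)
qed

lemma opow_carrier_add:
  "f \<in> opow_carrier r \<Longrightarrow> g \<in> opow_carrier r \<Longrightarrow> (\<lambda>x. f x + g x) \<in> opow_carrier r"
proof -
  assume a: "f \<in> opow_carrier r" "g \<in> opow_carrier r"
  have "{x. f x + g x \<noteq> 0} \<subseteq> {x. f x \<noteq> 0} \<union> {x. g x \<noteq> 0}" by auto
  then have "finite {x. f x + g x \<noteq> 0}"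
    by (rule finite_subset) (simp add: opow_carrier_finite[OF a(1)] opow_carrier_finite[OF a(2)] del: neq0_conv)
  then show ?thesis using a by (auto simp: opow_carrier_def)
qed

lemma finite_Well_order_max:
  assumes W: "Well_order r" and "finite A" "A \<noteq> {}" "A \<subseteq> Field r"
  obtains m where "m \<in> A" "\<And>a. a \<in> A \<Longrightarrow> (a, m) \<in> r"
proof -
  have "\<exists>m \<in> A. \<forall>a \<in> A. (a, m) \<in> r"
    using assms(2-4)
  proof (induction A rule: finite_ne_induct)
    case (singleton x)
    then show ?case using Well_order_refl[OF W] by auto
  next
    case (insert x F)
    then obtain m where m: "m \<in> F" "\<forall>a \<in> F. (a, m) \<in> r" by auto
    show ?case
    proof (cases "(x, m) \<in> r")
      case True
      then show ?thesis using m by auto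
    next
      case False
      then have "(m, x) \<in> r" using Well_order_total[OF W] m insert.prems by blast
      then show ?thesis
        using m Well_order_trans[OF W] Well_order_refl[OF W] insert.prems by blast
    qed
  qed
  then show ?thesis using that by blast
qed

lemma opow_less_total:
  assumes W: "Well_order r" and f: "f \<in> opow_carrier r" and g: "g \<in> opow_carrier r"
    and "f \<noteq> g"
  shows "opow_less r f g \<or> opow_less r g f"
proof -
  let ?A = "{x. f x \<noteq> g x}"
  have "?A \<subseteq> {x. f x \<noteq> 0} \<union> {x. g x \<noteq> 0}" by auto
  then have "finite ?A"
    by (rule finite_subset) (simp add: opow_carrier_finite[OF f] opow_carrier_finite[OF g] del: neq0_conv)
  moreover have "?A \<noteq> {}" using \<open>f \<noteq> g\<close> by auto
  moreover have "?A \<subseteq> Field r"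
  proof
    fix x assume "x \<in> ?A"
    then have "f x \<noteq> 0 \<or> g x \<noteq> 0" by auto
    then show "x \<in> Field r" using opow_carrier_Field[OF f] opow_carrier_Field[OF g] by blast
  qed
  ultimately obtain m where m: "m \<in> ?A" "\<And>a. a \<in> ?A \<Longrightarrow> (a, m) \<in> r"
    using finite_Well_order_max[OF W] by blast
  have "f y = g y" if "(m, y) \<in> r" "y \<noteq> m" for y
    using that m Well_order_antisym[OF W] by blast
  moreover have "f m < g m \<or> g m < f m" using m(1) by auto
  ultimately show ?thesis unfolding opow_less_def by metis
qed

text \<open>Pointwise addition of coefficients is the Hessenberg sum. It is strictly monotone
  because adding \<open>h\<close> on both sides does not move the largest position of
  disagreement.\<close>

lemma opow_less_add:
  "opow_less r f g \<Longrightarrow> opow_less r (\<lambda>x. f x + h x) (\<lambda>x. g x + h x)"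
  by (auto simp: opow_less_def)

text \<open>A normal form is a finite multiset of exponents. At the largest disagreement
  \<open>x\<close> the surplus is on the side of \<open>g\<close>, and every exponent that
  \<open>f\<close> has in surplus lies below \<open>x\<close>. Well-foundedness of
  \<open>omega_pow\<close> is thus inherited from the multiset order.\<close>

lemma opow_less_mult:
  assumes W: "Well_order r" and f: "f \<in> opow_carrier r" and g: "g \<in> opow_carrier r"
    and less: "opow_less r f g"
  shows "(Abs_multiset f, Abs_multiset g) \<in> mult (r - Id)"
proof -
  obtain x where x: "f x < g x" "\<And>y. (x, y) \<in> r \<Longrightarrow> y \<noteq> x \<Longrightarrow> f y = g y"
    using less by (auto simp: opow_less_def)
  have cf: "count (Abs_multiset f) = f" and cg: "count (Abs_multiset g) = g"
    using opow_carrier_finite[OF f] opow_carrier_finite[OF g]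
    by (simp_all add: Abs_multiset_inverse)
  let ?I = "Abs_multiset f \<inter># Abs_multiset g"
  let ?J = "Abs_multiset g - Abs_multiset f" and ?K = "Abs_multiset f - Abs_multiset g"
  have J: "x \<in># ?J" using x(1) by (simp add: in_diff_count cf cg)
  have xF: "x \<in> Field r" using x(1) opow_carrier_Field[OF g, of x] by simp
  have "\<exists>j \<in> set_mset ?J. (k, j) \<in> r - Id" if "k \<in> set_mset ?K" for k
  proof -
    have k: "g k < f k" using that by (simp add: in_diff_count cf cg)
    then have "k \<in> Field r" using opow_carrier_Field[OF f, of k] by simp
    moreover have "(x, k) \<notin> r" using x k by (metis less_asym less_irrefl)
    ultimately have "(k, x) \<in> r - Id"
      using Well_order_total[OF W xF] Well_order_refl[OF W xF] by auto
    then show ?thesis using J by blast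
  qed
  then have "(?I + ?K, ?I + ?J) \<in> mult (r - Id)"
    using J by (intro one_step_implies_mult) auto
  moreover have "?I + ?K = Abs_multiset f" "?I + ?J = Abs_multiset g"
    by (auto intro!: multiset_eqI)
  ultimately show ?thesis by simp
qed

lemma opow_less_irrefl: "\<not> opow_less r f f"
  by (simp add: opow_less_def)

lemma opow_less_trans:
  assumes W: "Well_order r" and g: "g \<in> opow_carrier r" and h: "h \<in> opow_carrier r"
    and "opow_less r f g" "opow_less r g h"
  shows "opow_less r f h"
proof -
  obtain x where x: "f x < g x" "\<And>y. (x, y) \<in> r \<Longrightarrow> y \<noteq> x \<Longrightarrow> f y = g y"
    using assms by (auto simp: opow_less_def)
  obtain z where z: "g z < h z" "\<And>y. (z, y) \<in> r \<Longrightarrow> y \<noteq> z \<Longrightarrow> g y = h y"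
    using assms by (auto simp: opow_less_def)
  have "x \<in> Field r" "z \<in> Field r"
    using x(1) z(1) opow_carrier_Field[OF g, of x] opow_carrier_Field[OF h, of z] by auto
  then consider "x = z" | "(x, z) \<in> r" "x \<noteq> z" | "(z, x) \<in> r" "x \<noteq> z"
    using Well_order_total[OF W] by blast
  then show ?thesis
  proof cases
    case 1
    then show ?thesis using x z unfolding opow_less_def by (metis less_trans)
  next
    case 2
    then have "f z < h z" using x(2) z(1) by auto
    moreover have "f y = h y" if "(z, y) \<in> r" "y \<noteq> z" for y
      using that 2 x(2) z(2) Well_order_trans[OF W] Well_order_antisym[OF W] by metis
    ultimately show ?thesis unfolding opow_less_def by blast
  next
    case 3
    then have "f x < h x" using x(1) z(2) by auto
    moreover have "f y = h y" if "(x, y) \<in> r" "y \<noteq> x" for y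
      using that 3 x(2) z(2) Well_order_trans[OF W] Well_order_antisym[OF W] by metis
    ultimately show ?thesis unfolding opow_less_def by blast
  qed
qed

lemma opow_less_asym:
  assumes "Well_order r" "f \<in> opow_carrier r" "g \<in> opow_carrier r" "opow_less r f g"
  shows "\<not> opow_less r g f"
  using opow_less_trans[OF assms(1,3,2,4)] opow_less_irrefl by blast

lemma Well_order_omega_pow:
  assumes W: "Well_order r"
  shows "Well_order (omega_pow r)"
proof -
  have "wf (inv_image (mult (r - Id)) Abs_multiset)"
    using W by (intro wf_inv_image wf_mult Well_order_wf)
  moreover have "omega_pow r - Id \<subseteq> inv_image (mult (r - Id)) Abs_multiset"
    using opow_less_mult[OF W] by (auto simp: omega_pow_iff)
  ultimately have "wf (omega_pow r - Id)" using wf_subset by blast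
  moreover have "Refl (omega_pow r)" by (auto simp: refl_on_def omega_pow_iff)
  moreover have "trans (omega_pow r)"
    using opow_less_trans[OF W] unfolding trans_def by (metis omega_pow_iff)
  moreover have "antisym (omega_pow r)"
    using opow_less_trans[OF W] opow_less_irrefl unfolding antisym_def by (metis omega_pow_iff)
  moreover have "Total (omega_pow r)"
    using opow_less_total[OF W] by (auto simp: total_on_def omega_pow_iff)
  moreover have "omega_pow r \<subseteq> Field (omega_pow r) \<times> Field (omega_pow r)"
    by (auto simp: omega_pow_iff)
  ultimately show ?thesis unfolding order_on_defs by blast
qed

lemma underS_omega_pow:
  "f \<in> opow_carrier r \<Longrightarrow> underS (omega_pow r) f = {g \<in> opow_carrier r. opow_less r g f}"
  using opow_less_irrefl[of r] by (auto simp: underS_def omega_pow_iff)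

abbreviation opow_single :: "'a \<Rightarrow> nat \<Rightarrow> 'a \<Rightarrow> nat" where
  "opow_single e k \<equiv> (\<lambda>_. 0)(e := k)"

text \<open>\<open>opow_single e 1\<close> is \<omega>^e. Its closure under natural sums can be read
  off the right-hand side, since the support of a sum is the union of the supports.\<close>

lemma opow_less_single_one:
  assumes W: "Well_order r" and e: "e \<in> Field r" and g: "g \<in> opow_carrier r"
  shows "opow_less r g (opow_single e 1) \<longleftrightarrow> {x. g x \<noteq> 0} \<subseteq> underS r e"
proof
  assume "opow_less r g (opow_single e 1)"
  then obtain x where x: "g x < (opow_single e 1) x"
    "\<And>y. (x, y) \<in> r \<Longrightarrow> y \<noteq> x \<Longrightarrow> g y = (opow_single e 1) y"
    unfolding opow_less_def by blast
  then have "x = e" "g e = 0" by (auto split: if_splits)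
  then have "y \<in> underS r e" if "g y \<noteq> 0" for y
    using that x(2)[of y] e opow_carrier_Field[OF g] Well_order_total[OF W, of e y]
    by (auto simp: underS_def split: if_splits)
  then show "{x. g x \<noteq> 0} \<subseteq> underS r e" by blast
next
  assume a: "{x. g x \<noteq> 0} \<subseteq> underS r e"
  have "g e = 0" using a by (auto simp: underS_def)
  moreover have "g y = 0" if "(e, y) \<in> r" "y \<noteq> e" for y
    using a that Well_order_antisym[OF W] by (fastforce simp: underS_def)
  ultimately show "opow_less r g (opow_single e 1)"
    unfolding opow_less_def by (intro exI[of _ e]) auto
qed

text \<open>\<open>p\<close> is the leading exponent of \<open>g\<close>, and \<open>k\<close>
  exceeds its coefficient by one. Zero has no leading exponent.\<close>

lemma opow_less_single_ex:
  assumes W: "Well_order r" and g: "g \<in> opow_carrier r" and supp: "{x. g x \<noteq> 0} \<subseteq> D"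
    and ne: "g \<noteq> (\<lambda>_. 0)"
  obtains p k where "p \<in> D" "p \<in> Field r" "opow_less r g (opow_single p k)"
proof -
  obtain p where p: "g p \<noteq> 0" "\<And>a. g a \<noteq> 0 \<Longrightarrow> (a, p) \<in> r"
    using finite_Well_order_max[OF W opow_carrier_finite[OF g]] ne opow_carrier_Field[OF g]
    by (metis (mono_tags, lifting) empty_Collect_eq ext mem_Collect_eq subsetI)
  have "g y = 0" if "(p, y) \<in> r" "y \<noteq> p" for y
    using that p(2) Well_order_antisym[OF W] by blast
  then have "opow_less r g (opow_single p (Suc (g p)))"
    unfolding opow_less_def by (intro exI[of _ p]) auto
  then show ?thesis using that p(1) supp opow_carrier_Field[OF g] by blast
qed

lemma opow_less_pointwise:
  assumes "Well_order R" "f \<in> opow_carrier R" "g \<in> opow_carrier R"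
    and "\<And>t. f t \<le> g t" "f t < g t"
  shows "opow_less R f g"
proof -
  have "f \<noteq> g" using assms(5) by auto
  moreover have "\<not> opow_less R g f" using assms(4) by (auto simp: opow_less_def not_less)
  ultimately show ?thesis using opow_less_total[OF assms(1-3)] by blast
qed

text \<open>The sum of the members is such a bound. It serves to move a copy past all of the
  finitely many elements already played without leaving the support \<open>D\<close>.\<close>

lemma opow_carrier_bound:
  assumes "finite F" "\<And>f. f \<in> F \<Longrightarrow> f \<in> opow_carrier R \<and> (\<forall>t. t \<notin> D \<longrightarrow> f t = 0)"
  shows "\<exists>c \<in> opow_carrier R. (\<forall>t. t \<notin> D \<longrightarrow> c t = 0) \<and> (\<forall>f \<in> F. \<forall>t. f t \<le> c t)"
  using assms
proof (induction F rule: finite_induct)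
  case empty
  then show ?case by (intro bexI[of _ "\<lambda>_. 0"]) auto
next
  case (insert f F)
  then obtain c where c: "c \<in> opow_carrier R" "\<forall>t. t \<notin> D \<longrightarrow> c t = 0" "\<forall>f \<in> F. \<forall>t. f t \<le> c t"
    by auto
  have "(\<lambda>t. c t + f t) \<in> opow_carrier R" using c(1) insert.prems by (intro opow_carrier_add) auto
  moreover have "\<forall>t. t \<notin> D \<longrightarrow> c t + f t = 0" using c(2) insert.prems by auto
  moreover have "\<forall>g \<in> insert f F. \<forall>t. g t \<le> c t + f t" using c(3) by (auto intro: trans_le_add1)
  ultimately show ?case by (intro bexI[of _ "\<lambda>t. c t + f t"] conjI)
qed

section \<open>Width via residuals\<close>

text \<open>\<open>Z\<close> is the pool of candidates left after \<open>x\<close> has been played.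
  The sequence itself can be forgotten, since the tree below \<open>s\<close> depends only on the
  elements incomparable to all of \<open>s\<close>.\<close>

definition residual :: "('x \<Rightarrow> 'x \<Rightarrow> bool) \<Rightarrow> ('x set \<times> 'x set) set" where
  "residual le = {({y \<in> Y. \<not> le x y \<and> \<not> le y x}, Y) | x Y. x \<in> Y}"

lemma residualI: "x \<in> Y \<Longrightarrow> ({y \<in> Y. \<not> le x y \<and> \<not> le y x}, Y) \<in> residual le"
  by (auto simp: residual_def)

lemma residualE:
  assumes "(Z, Y) \<in> residual le"
  obtains x where "x \<in> Y" "Z = {y \<in> Y. \<not> le x y \<and> \<not> le y x}"
  using assms by (auto simp: residual_def)

definition incomparables :: "'x set \<Rightarrow> ('x \<Rightarrow> 'x \<Rightarrow> bool) \<Rightarrow> 'x list \<Rightarrow> 'x set" where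
  "incomparables A le s = {y \<in> A. \<forall>z \<in> set s. \<not> le z y \<and> \<not> le y z}"

lemma antichain_seqs_snoc:
  assumes "s \<in> antichain_seqs A le"
  shows "s @ [x] \<in> antichain_seqs A le \<longleftrightarrow> x \<in> incomparables A le s"
proof
  assume a: "s @ [x] \<in> antichain_seqs A le"
  have "\<not> le z x \<and> \<not> le x z" if z: "z \<in> set s" for z
  proof -
    obtain i where "i < length s" "s ! i = z" using z by (auto simp: in_set_conv_nth)
    moreover have "\<forall>i < Suc (length s). \<forall>j < Suc (length s). i \<noteq> j \<longrightarrow>
        \<not> le ((s @ [x]) ! i) ((s @ [x]) ! j)"
      using a by (simp add: antichain_seqs_def)
    ultimately show ?thesis
      by (metis less_Suc_eq less_irrefl_nat nth_append nth_append_length)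
  qed
  then show "x \<in> incomparables A le s"
    using a by (auto simp: antichain_seqs_def incomparables_def)
next
  assume "x \<in> incomparables A le s"
  then show "s @ [x] \<in> antichain_seqs A le"
    using assms by (auto simp: antichain_seqs_def incomparables_def nth_append less_Suc_eq)
qed

lemma incomparables_snoc:
  "incomparables A le (s @ [x]) =
    {y \<in> incomparables A le s. \<not> le x y \<and> \<not> le y x}"
  by (auto simp: incomparables_def)

lemma rank_le_antichain_tree:
  assumes "rank_le (residual le) Y W" "s \<in> antichain_seqs A le" "Y = incomparables A le s"
  shows "rank_le (antichain_tree A le) s W"
  using assms
proof (induction arbitrary: s rule: rank_le.induct)
  case (1 Y W)
  show ?case
  proof (rule rank_le.intros, intro allI impI)
    fix t assume "(t, s) \<in> antichain_tree A le"
    then obtain x where x: "t = s @ [x]" "t \<in> antichain_seqs A le"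
      by (auto simp: antichain_tree_def)
    then have "x \<in> Y" using antichain_seqs_snoc 1 by fast
    then have "(incomparables A le t, Y) \<in> residual le"
      unfolding x(1) incomparables_snoc 1(3) by (rule residualI)
    then show "\<exists>w \<in> Field W. rank_le (antichain_tree A le) t (Restr W (underS W w))"
      using 1(1) x(2) by blast
  qed
qed

lemma rank_ge_antichain_tree:
  assumes "rank_ge (residual le) Y W" "s \<in> antichain_seqs A le" "Y = incomparables A le s"
  shows "rank_ge (antichain_tree A le) s W"
  using assms
proof (induction arbitrary: s rule: rank_ge.induct)
  case (1 W Y)
  show ?case
  proof (rule rank_ge.intros, intro ballI)
    fix w assume "w \<in> Field W"
    then obtain Z where Z: "(Z, Y) \<in> residual le"
      "\<And>s. s \<in> antichain_seqs A le \<Longrightarrow> Z = incomparables A le s \<Longrightarrow>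
        rank_ge (antichain_tree A le) s (Restr W (underS W w))"
      using 1(1) by blast
    then obtain x where x: "x \<in> Y" "Z = incomparables A le (s @ [x])"
      unfolding incomparables_snoc 1(3) by (elim residualE)
    then have s: "s @ [x] \<in> antichain_seqs A le" using 1 antichain_seqs_snoc by fast
    then have "(s @ [x], s) \<in> antichain_tree A le" by (auto simp: antichain_tree_def)
    then show "\<exists>t. (t, s) \<in> antichain_tree A le \<and>
        rank_ge (antichain_tree A le) t (Restr W (underS W w))"
      using Z(2)[OF s x(2)] by blast
  qed
qed

lemma width_isI:
  assumes "Well_order W" "rank_le (residual le) A W" "rank_ge (residual le) A W"
  shows "width_is A le W"
proof -
  have "[] \<in> antichain_seqs A le" "A = incomparables A le []"
    by (auto simp: antichain_seqs_def incomparables_def)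
  then show ?thesis
    using assms rank_le_antichain_tree rank_ge_antichain_tree
    unfolding width_is_def rank_is_def by metis
qed

section \<open>Residual ranks of subsets, images, unions and plays in succession\<close>

lemma rank_le_residual_mono:
  assumes W: "Well_order W" and "rank_le (residual le) Y (iseg W e)" "Z \<subseteq> Y"
  shows "rank_le (residual le) Z (iseg W e)"
proof (rule rank_le_sim[where P = "\<lambda>Z e. \<exists>Y. Z \<subseteq> Y \<and> rank_le (residual le) Y (iseg W e)", OF W])
  show "\<exists>Y. Z \<subseteq> Y \<and> rank_le (residual le) Y (iseg W e)" using assms by blast
next
  fix Z e Z'
  assume "\<exists>Y. Z \<subseteq> Y \<and> rank_le (residual le) Y (iseg W e)" and Z': "(Z', Z) \<in> residual le"
  then obtain Y where Y: "Z \<subseteq> Y" "rank_le (residual le) Y (iseg W e)" by blast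
  obtain x where x: "x \<in> Z" "Z' = {y \<in> Z. \<not> le x y \<and> \<not> le y x}" using Z' by (rule residualE)
  then have "({y \<in> Y. \<not> le x y \<and> \<not> le y x}, Y) \<in> residual le"
    using Y(1) by (intro residualI) blast
  then obtain w where "w \<in> below W e"
    "rank_le (residual le) {y \<in> Y. \<not> le x y \<and> \<not> le y x} (iseg W (Some w))"
    using rank_le_isegD[OF W Y(2)] by blast
  moreover have "Z' \<subseteq> {y \<in> Y. \<not> le x y \<and> \<not> le y x}" using x Y(1) by auto
  ultimately show "\<exists>w \<in> below W e. \<exists>Y. Z' \<subseteq> Y \<and> rank_le (residual le) Y (iseg W (Some w))" by blast
qed

text \<open>A move \<open>x\<close> in \<open>Z\<close> is answered by \<open>h x\<close> in
  \<open>Y\<close>. As \<open>h\<close> creates no new comparabilities, the image of what is left of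
  \<open>Z\<close> survives that move.\<close>

lemma rank_ge_residual_map:
  assumes W: "Well_order W" and "rank_ge (residual le) Z (iseg W e)"
    and "\<And>x. x \<in> Z \<Longrightarrow> h x \<in> Y"
    and "\<And>x y. x \<in> Z \<Longrightarrow> y \<in> Z \<Longrightarrow> \<not> le x y \<Longrightarrow> \<not> le (h x) (h y)"
  shows "rank_ge (residual le) Y (iseg W e)"
proof (rule rank_ge_sim[where P = "\<lambda>Y e. \<exists>Z. rank_ge (residual le) Z (iseg W e) \<and> h ` Z \<subseteq> Y \<and>
    (\<forall>x \<in> Z. \<forall>y \<in> Z. \<not> le x y \<longrightarrow> \<not> le (h x) (h y))", OF W])
  show "\<exists>Z. rank_ge (residual le) Z (iseg W e) \<and> h ` Z \<subseteq> Y \<and>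
      (\<forall>x \<in> Z. \<forall>y \<in> Z. \<not> le x y \<longrightarrow> \<not> le (h x) (h y))"
  proof (intro exI[of _ Z] conjI ballI impI)
    show "h ` Z \<subseteq> Y" using assms(3) by (rule image_subsetI)
    show "\<not> le (h x) (h y)" if "x \<in> Z" "y \<in> Z" "\<not> le x y" for x y
      using that by (rule assms(4))
  qed (rule assms(2))
next
  fix Y e w
  assume "\<exists>Z. rank_ge (residual le) Z (iseg W e) \<and> h ` Z \<subseteq> Y \<and>
      (\<forall>x \<in> Z. \<forall>y \<in> Z. \<not> le x y \<longrightarrow> \<not> le (h x) (h y))" and w: "w \<in> below W e"
  then obtain Z where Z: "rank_ge (residual le) Z (iseg W e)" "h ` Z \<subseteq> Y"
    "\<forall>x \<in> Z. \<forall>y \<in> Z. \<not> le x y \<longrightarrow> \<not> le (h x) (h y)" by (elim exE conjE) (rule that)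
  obtain Z' where "(Z', Z) \<in> residual le" and ge: "rank_ge (residual le) Z' (iseg W (Some w))"
    using rank_ge_isegD[OF W Z(1) w] by blast
  then obtain x where x: "x \<in> Z" "Z' = {y \<in> Z. \<not> le x y \<and> \<not> le y x}" by (elim residualE)
  show "\<exists>Y'. (Y', Y) \<in> residual le \<and> (\<exists>Z. rank_ge (residual le) Z (iseg W (Some w)) \<and>
      h ` Z \<subseteq> Y' \<and> (\<forall>x \<in> Z. \<forall>y \<in> Z. \<not> le x y \<longrightarrow> \<not> le (h x) (h y)))"
  proof (intro exI conjI)
    show "({y \<in> Y. \<not> le (h x) y \<and> \<not> le y (h x)}, Y) \<in> residual le"
      using x(1) Z(2) by (intro residualI) blast
    show "rank_ge (residual le) Z' (iseg W (Some w))" by (rule ge)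
    show "h ` Z' \<subseteq> {y \<in> Y. \<not> le (h x) y \<and> \<not> le y (h x)}" using x Z(2,3) by blast
    show "\<forall>x \<in> Z'. \<forall>y \<in> Z'. \<not> le x y \<longrightarrow> \<not> le (h x) (h y)" using x(2) Z(3) by blast
  qed
qed

lemma rank_ge_residual_mono:
  assumes "Well_order W" "rank_ge (residual le) Z (iseg W e)" "Z \<subseteq> Y"
  shows "rank_ge (residual le) Y (iseg W e)"
  using rank_ge_residual_map[OF assms(1,2), of "\<lambda>x. x" Y] assms(3) by blast

text \<open>A move in one part lowers the bound of that part, and the bound of the other part
  persists because a residual is a subset. The moves may alternate arbitrarily, so the sum has to be
  strictly monotone in both arguments, which the ordinary ordinal sum is not.\<close>

lemma rank_le_residual_Un:
  assumes E: "Well_order E"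
    and "f \<in> opow_carrier E" "rank_le (residual le) A (iseg (omega_pow E) (Some f))"
    and "g \<in> opow_carrier E" "rank_le (residual le) B (iseg (omega_pow E) (Some g))"
  shows "rank_le (residual le) (A \<union> B) (iseg (omega_pow E) (Some (\<lambda>x. f x + g x)))"
proof -
  note W = Well_order_omega_pow[OF E]
  define le_rank where
    "le_rank A f \<longleftrightarrow> f \<in> opow_carrier E \<and> rank_le (residual le) A (iseg (omega_pow E) (Some f))" for A f
  have step: "\<exists>f'. opow_less E f' f \<and> le_rank {y \<in> A. \<not> le x y \<and> \<not> le y x} f'"
    if "le_rank A f" "x \<in> A" for A f x
    using that rank_le_isegD[OF W _ residualI[OF that(2)], where e = "Some f"]
      underS_omega_pow[of f E]
    unfolding le_rank_def by auto
  have mono: "le_rank {y \<in> A. \<not> le x y \<and> \<not> le y x} f" if "le_rank A f" for A f x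
    using that rank_le_residual_mono[OF W, of le A "Some f" "{y \<in> A. \<not> le x y \<and> \<not> le y x}"]
    unfolding le_rank_def by simp
  show ?thesis
  proof (rule rank_le_sim[where P = "\<lambda>Y e. \<exists>A B f g. Y = A \<union> B \<and> e = Some (\<lambda>x. f x + g x) \<and>
        le_rank A f \<and> le_rank B g", OF W])
    show "\<exists>A' B' f' g'. A \<union> B = A' \<union> B' \<and> Some (\<lambda>x. f x + g x) = Some (\<lambda>x. f' x + g' x) \<and>
        le_rank A' f' \<and> le_rank B' g'"
      by (rule exI[of _ A], rule exI[of _ B], rule exI[of _ f], rule exI[of _ g])
        (use assms in \<open>simp add: le_rank_def\<close>)
  next
    fix Y e Z
    assume "\<exists>A B f g. Y = A \<union> B \<and> e = Some (\<lambda>x. f x + g x) \<and> le_rank A f \<and> le_rank B g"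
      and Z: "(Z, Y) \<in> residual le"
    then obtain A B f g where AB: "Y = A \<union> B" "e = Some (\<lambda>x. f x + g x)"
      "le_rank A f" "le_rank B g" by (elim exE conjE) (rule that)
    obtain x where x: "x \<in> Y" "Z = {y \<in> Y. \<not> le x y \<and> \<not> le y x}" using Z by (rule residualE)
    let ?A = "{y \<in> A. \<not> le x y \<and> \<not> le y x}" and ?B = "{y \<in> B. \<not> le x y \<and> \<not> le y x}"
    have Z_eq: "Z = ?A \<union> ?B" using x AB(1) by auto
    have car: "f \<in> opow_carrier E" "g \<in> opow_carrier E" using AB by (auto simp: le_rank_def)
    have bel: "below (omega_pow E) e = {h \<in> opow_carrier E. opow_less E h (\<lambda>x. f x + g x)}"
      using car by (simp add: AB(2) underS_omega_pow opow_carrier_add)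
    have "\<exists>f' g'. (\<lambda>x. f' x + g' x) \<in> below (omega_pow E) e \<and> le_rank ?A f' \<and> le_rank ?B g'"
    proof (cases "x \<in> A")
      case True
      then obtain f' where f': "opow_less E f' f" "le_rank ?A f'" using step[OF AB(3)] by blast
      then show ?thesis
        using mono[OF AB(4)] opow_less_add[OF f'(1)] car unfolding bel le_rank_def
        by (intro exI[of _ f'] exI[of _ g]) (simp add: opow_carrier_add)
    next
      case False
      then obtain g' where g': "opow_less E g' g" "le_rank ?B g'"
        using step[OF AB(4)] x(1) AB(1) by blast
      then show ?thesis
        using mono[OF AB(3)] opow_less_add[OF g'(1), of f] car unfolding bel le_rank_def
        by (intro exI[of _ f] exI[of _ g']) (simp add: opow_carrier_add add.commute)
    qed
    then obtain f' g' where "(\<lambda>x. f' x + g' x) \<in> below (omega_pow E) e"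
      "le_rank ?A f'" "le_rank ?B g'" by (elim exE conjE) (rule that)
    then show "\<exists>w \<in> below (omega_pow E) e. \<exists>A B f g. Z = A \<union> B \<and>
        Some w = Some (\<lambda>x. f x + g x) \<and> le_rank A f \<and> le_rank B g"
      using Z_eq by (intro bexI exI conjI) (rule refl | assumption)+
  qed
qed

lemma rank_le_residual_empty:
  "Well_order W \<Longrightarrow> rank_le (residual le) {} (iseg W e)"
  by (subst rank_le_iseg) (auto elim: residualE)

lemma rank_le_residual_UN:
  assumes E: "Well_order E" and "finite T"
    and "\<And>t. t \<in> T \<Longrightarrow> \<exists>w \<in> below E e.
      rank_le (residual le) (Y t) (iseg (omega_pow E) (Some (opow_single w 1)))"
  shows "\<exists>g \<in> opow_carrier E. {x. g x \<noteq> 0} \<subseteq> below E e \<and>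
      rank_le (residual le) (\<Union>t \<in> T. Y t) (iseg (omega_pow E) (Some g))"
  using assms(2,3)
proof (induction T rule: finite_induct)
  case empty
  then show ?case
    using rank_le_residual_empty[OF Well_order_omega_pow[OF E]]
    by (intro bexI[of _ "\<lambda>_. 0"]) auto
next
  case (insert t T)
  then obtain g where g: "g \<in> opow_carrier E" "{x. g x \<noteq> 0} \<subseteq> below E e"
    "rank_le (residual le) (\<Union>t \<in> T. Y t) (iseg (omega_pow E) (Some g))" by blast
  obtain w where w: "w \<in> below E e"
    "rank_le (residual le) (Y t) (iseg (omega_pow E) (Some (opow_single w 1)))"
    using insert.prems by blast
  have wc: "opow_single w 1 \<in> opow_carrier E"
    using w(1) below_subset_Field[of E e] by (intro opow_carrier_upd) auto
  let ?g = "\<lambda>x. opow_single w 1 x + g x"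
  have "?g \<in> opow_carrier E" using wc g(1) by (rule opow_carrier_add)
  moreover have "{x. ?g x \<noteq> 0} \<subseteq> below E e" using g(2) w(1) by auto
  moreover have "rank_le (residual le) (\<Union>t \<in> insert t T. Y t) (iseg (omega_pow E) (Some ?g))"
    using rank_le_residual_Un[OF E wc w(2) g(1,3)] by (simp only: UN_insert)
  ultimately show ?case by (intro bexI[of _ ?g] conjI)
qed

text \<open>Here \<open>\<omega>\<^sup>p \<cdot> k + f\<close> is an ordinal sum because \<open>f\<close> vanishes above \<open>p\<close>: the play in
  \<open>Z\<close> consumes \<open>f\<close> first, and the remaining \<open>\<omega>\<^sup>p \<cdot> k\<close> is realised in a set chosen
  afterwards, depending on the finitely many elements played.\<close>

lemma rank_ge_residual_add:
  assumes E: "Well_order E" and p: "p \<in> Field E"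
    and "f \<in> opow_carrier E" "\<And>y. (p, y) \<in> E \<Longrightarrow> y \<noteq> p \<Longrightarrow> f y = 0"
    and "rank_ge (residual le) Z (iseg (omega_pow E) (Some f))" "Z \<subseteq> Y"
    and "\<And>F. finite F \<Longrightarrow> F \<subseteq> Z \<Longrightarrow> \<exists>Z0 \<subseteq> Y. (\<forall>z \<in> Z0. \<forall>x \<in> F. \<not> le x z \<and> \<not> le z x) \<and>
        rank_ge (residual le) Z0 (iseg (omega_pow E) (Some (opow_single p k)))"
  shows "rank_ge (residual le) Y (iseg (omega_pow E) (Some (\<lambda>x. opow_single p k x + f x)))"
proof -
  note W = Well_order_omega_pow[OF E]
  let ?g = "opow_single p k"
  have gc: "?g \<in> opow_carrier E" using p by (simp add: opow_carrier_upd)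
  define inv where "inv Z Y f \<longleftrightarrow> f \<in> opow_carrier E \<and> (\<forall>y. (p, y) \<in> E \<longrightarrow> y \<noteq> p \<longrightarrow> f y = 0) \<and>
    rank_ge (residual le) Z (iseg (omega_pow E) (Some f)) \<and> Z \<subseteq> Y \<and>
    (\<forall>F. finite F \<longrightarrow> F \<subseteq> Z \<longrightarrow> (\<exists>Z0 \<subseteq> Y. (\<forall>z \<in> Z0. \<forall>x \<in> F. \<not> le x z \<and> \<not> le z x) \<and>
        rank_ge (residual le) Z0 (iseg (omega_pow E) (Some ?g))))" for Z Y f
  \<comment> \<open>First alternative: the play has moved on to a set chosen on the way, and its
    rank is known outright. Second alternative: \<omega>^p \<cdot> k is still untouched and
    \<open>f\<close> is being consumed in \<open>Z\<close>.\<close>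
  define Q where "Q Y e \<longleftrightarrow> rank_ge (residual le) Y (iseg (omega_pow E) e) \<or>
      (\<exists>Z f. e = Some (\<lambda>x. ?g x + f x) \<and> inv Z Y f)" for Y e
  have Q1: "Q Y e" if "rank_ge (residual le) Y (iseg (omega_pow E) e)" for Y e
    unfolding Q_def using that by (rule disjI1)
  have Q2: "Q Y (Some (\<lambda>x. ?g x + f x))" if "inv Z Y f" for Y f Z
    unfolding Q_def by (rule disjI2, rule exI[of _ Z], rule exI[of _ f]) (simp only: that)
  have "inv Z Y f" unfolding inv_def using assms(3-7) by simp
  then have init: "Q Y (Some (\<lambda>x. ?g x + f x))" by (rule Q2)
  have step: "\<exists>Y'. (Y', Y) \<in> residual le \<and> Q Y' (Some v)"
    if P: "Q Y e" and v: "v \<in> below (omega_pow E) e" for Y e v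
  proof (cases "rank_ge (residual le) Y (iseg (omega_pow E) e)")
    case True
    obtain Y' where Y': "(Y', Y) \<in> residual le"
      "rank_ge (residual le) Y' (iseg (omega_pow E) (Some v))"
      using rank_ge_isegD[OF W True v] by (elim exE conjE) (rule that)
    show ?thesis by (rule exI, rule conjI[OF Y'(1) Q1[OF Y'(2)]])
  next
    case False
    then have "\<exists>Z f. e = Some (\<lambda>x. ?g x + f x) \<and> inv Z Y f" using P unfolding Q_def by (simp only: simp_thms)
    then obtain Z f where e: "e = Some (\<lambda>x. ?g x + f x)" and inv: "inv Z Y f"
      by (elim exE conjE) (rule that)
    note inv' = inv[unfolded inv_def]
    have f: "f \<in> opow_carrier E" "\<And>y. (p, y) \<in> E \<Longrightarrow> y \<noteq> p \<Longrightarrow> f y = 0"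
      using inv' by simp_all
    have geZ: "rank_ge (residual le) Z (iseg (omega_pow E) (Some f))" and ZY: "Z \<subseteq> Y"
      using inv' by blast+
    have ch: "\<exists>Z0 \<subseteq> Y. (\<forall>z \<in> Z0. \<forall>x \<in> F. \<not> le x z \<and> \<not> le z x) \<and>
        rank_ge (residual le) Z0 (iseg (omega_pow E) (Some ?g))" if "finite F" "F \<subseteq> Z" for F
      using inv' that by (elim conjE allE[of _ F] impE) assumption+
    have vc: "v \<in> opow_carrier E" and "opow_less E v (\<lambda>x. ?g x + f x)"
      using v[unfolded e below_Some underS_omega_pow[OF opow_carrier_add[OF gc f(1)]]]
      by (simp_all only: mem_Collect_eq)
    then obtain x where x: "v x < ?g x + f x"
      "\<And>y. (x, y) \<in> E \<Longrightarrow> y \<noteq> x \<Longrightarrow> v y = ?g y + f y"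
      unfolding opow_less_def by blast
    have xF: "x \<in> Field E"
      using x(1) opow_carrier_Field[OF f(1), of x] p by (auto split: if_splits)
    have xp: "(x, p) \<in> E"
    proof (rule ccontr)
      assume n: "(x, p) \<notin> E"
      then have "x \<noteq> p" "(p, x) \<in> E"
        using Well_order_total[OF E xF p] Well_order_refl[OF E p] by auto
      then show False using x(1) f(2)[of x] by simp
    qed
    have v_above: "v y = 0" if "(p, y) \<in> E" "y \<noteq> p" for y
    proof -
      have "(x, y) \<in> E" "y \<noteq> x"
        using that xp Well_order_trans[OF E] Well_order_antisym[OF E] by metis+
      then show ?thesis using x(2) f(2) that by simp
    qed
    show ?thesis
    proof (cases "v p < k")
      case True
      then have "opow_less E v ?g"
        unfolding opow_less_def using v_above by (intro exI[of _ p]) auto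
      then have "v \<in> below (omega_pow E) (Some ?g)" using vc gc by (simp add: underS_omega_pow)
      \<comment> \<open>Now \<open>v\<close> is below \<omega>^p \<cdot> k, so the rest of
        \<open>f\<close> is skipped. The empty set is enough here, because everything comparable to
        an earlier move has already been removed from \<open>Y\<close>.\<close>
      moreover obtain Z0 where "Z0 \<subseteq> Y"
        "rank_ge (residual le) Z0 (iseg (omega_pow E) (Some ?g))"
        using ch[of "{}"] by auto
      ultimately obtain Y' where Y': "(Y', Y) \<in> residual le"
        "rank_ge (residual le) Y' (iseg (omega_pow E) (Some v))"
        using rank_ge_isegD[OF W rank_ge_residual_mono[OF W]] by blast
      show ?thesis by (rule exI, rule conjI[OF Y'(1) Q1[OF Y'(2)]])
    next
      case False
      define f' where "f' = v(p := v p - k)"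
      have v_eq: "v = (\<lambda>x. ?g x + f' x)" using False by (auto simp: f'_def)
      have f'c: "f' \<in> opow_carrier E" unfolding f'_def by (rule opow_carrier_upd[OF vc p])
      have "f' x < f x" using x(1) False by (auto simp: f'_def split: if_splits)
      moreover have "f' y = f y" if "(x, y) \<in> E" "y \<noteq> x" for y
        using x(2)[OF that] by (auto simp: f'_def)
      ultimately have "opow_less E f' f" unfolding opow_less_def by blast
      then have "f' \<in> below (omega_pow E) (Some f)" using f(1) f'c by (simp add: underS_omega_pow)
      then obtain Z' where "(Z', Z) \<in> residual le"
        and ge: "rank_ge (residual le) Z' (iseg (omega_pow E) (Some f'))"
        using rank_ge_isegD[OF W geZ] by blast
      then obtain a where a: "a \<in> Z" "Z' = {y \<in> Z. \<not> le a y \<and> \<not> le y a}" by (elim residualE)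
      let ?Y = "{y \<in> Y. \<not> le a y \<and> \<not> le y a}"
      have "\<exists>Z0 \<subseteq> ?Y. (\<forall>z \<in> Z0. \<forall>x \<in> F. \<not> le x z \<and> \<not> le z x) \<and>
          rank_ge (residual le) Z0 (iseg (omega_pow E) (Some ?g))"
        if "finite F" "F \<subseteq> Z'" for F
      proof -
        \<comment> \<open>The move \<open>a\<close> is charged to the finite set: what is chosen for
          \<open>insert a F\<close> is incomparable to \<open>a\<close> and therefore lies in the
          residual \<open>?Y\<close>.\<close>
        have "finite (insert a F)" "insert a F \<subseteq> Z" using that a by auto
        then obtain Z0 where "Z0 \<subseteq> Y" "\<forall>z \<in> Z0. \<forall>x \<in> insert a F. \<not> le x z \<and> \<not> le z x"
          "rank_ge (residual le) Z0 (iseg (omega_pow E) (Some ?g))"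
          using ch by meson
        then show ?thesis by (intro exI[of _ Z0]) auto
      qed
      moreover have "Z' \<subseteq> ?Y" using a ZY by auto
      moreover have "\<forall>y. (p, y) \<in> E \<longrightarrow> y \<noteq> p \<longrightarrow> f' y = 0"
        using v_above by (auto simp: f'_def)
      ultimately have "inv Z' ?Y f'" using f'c ge unfolding inv_def by simp
      then have "Q ?Y (Some (\<lambda>x. ?g x + f' x))" by (rule Q2)
      then have "Q ?Y (Some v)" using v_eq by (simp only:)
      moreover have "(?Y, Y) \<in> residual le" using a(1) ZY by (intro residualI) auto
      ultimately show ?thesis by (intro exI conjI)
    qed
  qed
  show ?thesis using W init step by (rule rank_ge_sim)
qed

section \<open>Products of powers of omega\<close>

definition dec_rel ::
  "nat \<Rightarrow> (nat \<Rightarrow> 'a rel) \<Rightarrow> ((nat \<Rightarrow> 'a option) \<times> (nat \<Rightarrow> 'a option)) set" where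
  "dec_rel n r = {(b(i := Some q), b) | b i j q. i < n \<and> j < n \<and> j \<noteq> i \<and>
     q \<in> below (r i) (b i) \<and> below (r j) (b j) \<noteq> {}}"

text \<open>A translated copy of the product of the \<omega>^(b i): coefficients at positions in
  \<open>below (r i) (b i)\<close> are free, the higher ones are frozen to those of
  \<open>c\<close>.\<close>

definition cyl ::
  "nat \<Rightarrow> (nat \<Rightarrow> 'a rel) \<Rightarrow> (nat \<Rightarrow> 'a option) \<Rightarrow> (nat \<Rightarrow> 'a \<Rightarrow> nat) \<Rightarrow> (nat \<Rightarrow> 'a \<Rightarrow> nat) set" where
  "cyl n r b c = {x \<in> prod_X n r. \<forall>i < n. \<forall>p \<in> Field (r i) - below (r i) (b i). x i p = c i p}"

lemma cyl_subset: "cyl n r b c \<subseteq> prod_X n r"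
  by (auto simp: cyl_def)

lemma cyl_None: "cyl n r (\<lambda>_. None) c = prod_X n r"
  by (auto simp: cyl_def)

lemma prod_X_carrier: "x \<in> prod_X n r \<Longrightarrow> i < n \<Longrightarrow> x i \<in> opow_carrier (r i)"
  by (simp add: prod_X_def)

lemma prod_X_add:
  "x \<in> prod_X n r \<Longrightarrow> d \<in> prod_X n r \<Longrightarrow> (\<lambda>i p. x i p + d i p) \<in> prod_X n r"
  by (auto simp: prod_X_def opow_carrier_add)

text \<open>Finite support of each \<open>x i\<close> keeps the cover of a residual finite. A triple
  \<open>(i, p, v)\<close> records the coordinate, the highest position at which a smaller element
  deviates from \<open>x\<close>, and its value there; \<open>P\<close> leaves room for the side
  condition on a second coordinate.\<close>

lemma finite_cyl_index:
  assumes x: "x \<in> cyl n r b c"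
  shows "finite {(i, p, v). i < n \<and> p \<in> below (r i) (b i) \<and> v < x i p \<and> P i p v}"
proof (rule finite_subset)
  show "{(i, p, v). i < n \<and> p \<in> below (r i) (b i) \<and> v < x i p \<and> P i p v} \<subseteq>
      (SIGMA i:{..<n}. SIGMA p:{p. x i p \<noteq> 0}. {..<x i p})"
    by auto
  have "finite {p. x i p \<noteq> 0}" if "i < n" for i
    using prod_X_carrier[OF _ that] x cyl_subset by (intro opow_carrier_finite) blast
  then show "finite (SIGMA i:{..<n}. SIGMA p:{p. x i p \<noteq> 0}. {..<x i p})"
    by (intro finite_SigmaI) auto
qed

context
  fixes n :: nat and r :: "nat \<Rightarrow> 'a rel"
  assumes wo: "\<And>i. i < n \<Longrightarrow> Well_order (r i)"
begin

section \<open>Upper bound for the width of a product\<close>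

lemma not_prod_leD:
  assumes "x \<in> prod_X n r" "y \<in> prod_X n r" "\<not> prod_le n r x y"
  obtains i where "i < n" "opow_less (r i) (y i) (x i)"
  using assms opow_less_total[OF wo] that unfolding prod_le_def omega_pow_iff
  by (metis prod_X_carrier)

lemma not_prod_leI:
  assumes "x \<in> prod_X n r" "y \<in> prod_X n r" "i < n" "opow_less (r i) (y i) (x i)"
  shows "\<not> prod_le n r x y"
proof -
  have "\<not> opow_less (r i) (x i) (y i)" "x i \<noteq> y i"
    using opow_less_asym[OF wo[OF assms(3)] _ _ assms(4)] prod_X_carrier[OF _ assms(3)] assms
      opow_less_irrefl by metis+
  then show ?thesis using assms(3) unfolding prod_le_def omega_pow_iff by blast
qed

text \<open>If \<open>y\<close> is incomparable to \<open>x\<close>, then \<open>y i < x i\<close> for some \<open>i\<close>; freezing \<open>y i\<close> from the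
  largest position of disagreement on puts \<open>y\<close> into one of finitely many smaller cylinders.\<close>

lemma cyl_residual_cover:
  assumes x: "x \<in> cyl n r b c"
  shows "{y \<in> cyl n r b c. \<not> prod_le n r x y \<and> \<not> prod_le n r y x} \<subseteq>
    (\<Union>(i, p, v) \<in> {(i, p, v). i < n \<and> p \<in> below (r i) (b i) \<and> v < x i p \<and>
        (\<exists>j < n. j \<noteq> i \<and> below (r j) (b j) \<noteq> {})}.
      cyl n r (b(i := Some p)) (x(i := (x i)(p := v))))"
proof
  fix y assume "y \<in> {y \<in> cyl n r b c. \<not> prod_le n r x y \<and> \<not> prod_le n r y x}"
  then have y: "y \<in> cyl n r b c" and "\<not> prod_le n r x y" "\<not> prod_le n r y x" by auto
  then obtain i j where i: "i < n" "opow_less (r i) (y i) (x i)"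
    and j: "j < n" "opow_less (r j) (x j) (y j)"
    using not_prod_leD x y cyl_subset by (metis subsetD)
  have car: "x k \<in> opow_carrier (r k)" "y k \<in> opow_carrier (r k)" if "k < n" for k
    using prod_X_carrier[OF _ that] x y cyl_subset by blast+
  have agree: "x k p = y k p" if "k < n" "p \<notin> below (r k) (b k)" for k p
  proof (cases "p \<in> Field (r k)")
    case True
    then show ?thesis using that x y by (auto simp: cyl_def)
  next
    case False
    then have "x k p = 0" "y k p = 0"
      using opow_carrier_Field car[OF that(1)] by metis+
    then show ?thesis by simp
  qed
  obtain p where p: "y i p < x i p" "\<And>q. (p, q) \<in> r i \<Longrightarrow> q \<noteq> p \<Longrightarrow> y i q = x i q"
    using i(2) unfolding opow_less_def by metis
  \<comment> \<open>The coordinate \<open>j\<close> in which \<open>y\<close> exceeds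
    \<open>x\<close> supplies the second nonzero entry demanded by \<open>dec_rel\<close>: outside
    \<open>below (r j) (b j)\<close> the two agree, so they differ inside it.\<close>
  have "j \<noteq> i"
    using opow_less_asym[OF wo[OF i(1)] car(2)[OF i(1)] car(1)[OF i(1)] i(2)] j(2) by auto
  moreover have "below (r j) (b j) \<noteq> {}"
    using agree[OF j(1)] j(2) opow_less_irrefl[of "r j" "x j"]
    by (metis empty_iff ext)
  ultimately have "\<exists>j < n. j \<noteq> i \<and> below (r j) (b j) \<noteq> {}" using j(1) by blast
  moreover have pb: "p \<in> below (r i) (b i)" using agree[OF i(1)] p(1) by (metis less_irrefl)
  moreover have "y \<in> cyl n r (b(i := Some p)) (x(i := (x i)(p := y i p)))"
  proof -
    have "y k q = (x(i := (x i)(p := y i p))) k q"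
      if k: "k < n" and q: "q \<in> Field (r k)" "q \<notin> below (r k) ((b(i := Some p)) k)" for k q
    proof (cases "k = i \<and> q \<noteq> p")
      case True
      then have "(p, q) \<in> r i"
        using q Well_order_total[OF wo[OF i(1)], of p q] pb below_subset_Field[of "r i" "b i"]
        by (auto simp: underS_def)
      then show ?thesis using True p(2) by simp
    next
      case False
      then show ?thesis using agree[OF k, of q] q(2) by auto
    qed
    then show ?thesis using y by (auto simp: cyl_def)
  qed
  ultimately show "y \<in> (\<Union>(i, p, v) \<in> {(i, p, v). i < n \<and> p \<in> below (r i) (b i) \<and> v < x i p \<and>
        (\<exists>j < n. j \<noteq> i \<and> below (r j) (b j) \<noteq> {})}.
      cyl n r (b(i := Some p)) (x(i := (x i)(p := v))))"
    using i(1) p(1) by (intro UN_I[of "(i, p, y i p)"]) simp_all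
qed

text \<open>The induction hypothesis is an assumption and \<open>e\<close> an option, so that the
  same step serves \<omega>^e inside the well-founded induction and the top ordinal \<omega>^E,
  which is not of the form \<open>opow_single e 1\<close>.\<close>

lemma rank_le_cyl_residual:
  assumes E: "Well_order E" and le: "rank_le (dec_rel n r) b (iseg E e)"
    and x: "x \<in> cyl n r b c"
    and IH: "\<And>w b c. w \<in> below E e \<Longrightarrow> rank_le (dec_rel n r) b (iseg E (Some w)) \<Longrightarrow>
      rank_le (residual (prod_le n r)) (cyl n r b c) (iseg (omega_pow E) (Some (opow_single w 1)))"
  shows "\<exists>g \<in> opow_carrier E. {x. g x \<noteq> 0} \<subseteq> below E e \<and>
    rank_le (residual (prod_le n r))
      {y \<in> cyl n r b c. \<not> prod_le n r x y \<and> \<not> prod_le n r y x} (iseg (omega_pow E) (Some g))"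
proof -
  let ?T = "{(i, p, v). i < n \<and> p \<in> below (r i) (b i) \<and> v < x i p \<and>
        (\<exists>j < n. j \<noteq> i \<and> below (r j) (b j) \<noteq> {})}"
  let ?C = "\<lambda>(i, p, v). cyl n r (b(i := Some p)) (x(i := (x i)(p := v)))"
  have T: "finite ?T" by (rule finite_cyl_index[OF x])
  have C: "\<exists>w \<in> below E e. rank_le (residual (prod_le n r)) (?C t)
      (iseg (omega_pow E) (Some (opow_single w 1)))" if "t \<in> ?T" for t
  proof -
    obtain i p v where t: "t = (i, p, v)" by (cases t) auto
    then have "(b(i := Some p), b) \<in> dec_rel n r" using that by (auto simp: dec_rel_def)
    then obtain w where "w \<in> below E e" "rank_le (dec_rel n r) (b(i := Some p)) (iseg E (Some w))"
      using rank_le_isegD[OF E le] by blast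
    then show ?thesis unfolding t prod.case by (intro bexI IH)
  qed
  have "\<exists>g \<in> opow_carrier E. {x. g x \<noteq> 0} \<subseteq> below E e \<and>
      rank_le (residual (prod_le n r)) (\<Union>t \<in> ?T. ?C t) (iseg (omega_pow E) (Some g))"
    by (rule rank_le_residual_UN[OF E T]) (rule C)
  then obtain g where g: "g \<in> opow_carrier E" "{x. g x \<noteq> 0} \<subseteq> below E e"
    "rank_le (residual (prod_le n r)) (\<Union>t \<in> ?T. ?C t) (iseg (omega_pow E) (Some g))"
    by (elim bexE conjE) (rule that)
  show ?thesis
    using rank_le_residual_mono[OF Well_order_omega_pow[OF E] g(3) cyl_residual_cover[OF x]] g(1,2)
    by (intro bexI[of _ g] conjI)
qed

lemma rank_le_cyl:
  assumes E: "Well_order E" and "e \<in> Field E" "rank_le (dec_rel n r) b (iseg E (Some e))"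
  shows "rank_le (residual (prod_le n r)) (cyl n r b c) (iseg (omega_pow E) (Some (opow_single e 1)))"
  using Well_order_wf[OF E] assms(2,3)
proof (induction e arbitrary: b c rule: wf_induct_rule)
  case (less e)
  show ?case
  proof (subst rank_le_iseg[OF Well_order_omega_pow[OF E]], intro allI impI)
    fix Z assume "(Z, cyl n r b c) \<in> residual (prod_le n r)"
    then obtain x where x: "x \<in> cyl n r b c"
      and Z: "Z = {y \<in> cyl n r b c. \<not> prod_le n r x y \<and> \<not> prod_le n r y x}" by (rule residualE)
    have IH: "rank_le (residual (prod_le n r)) (cyl n r b c) (iseg (omega_pow E) (Some (opow_single w 1)))"
      if "w \<in> below E (Some e)" "rank_le (dec_rel n r) b (iseg E (Some w))" for w b c
      by (rule less.IH[OF _ _ that(2)]) (use that(1) in \<open>auto simp: underS_def Field_def\<close>)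
    have "\<exists>g \<in> opow_carrier E. {x. g x \<noteq> 0} \<subseteq> below E (Some e) \<and>
        rank_le (residual (prod_le n r)) Z (iseg (omega_pow E) (Some g))"
      unfolding Z by (rule rank_le_cyl_residual[OF E less.prems(2) x]) (rule IH)
    then obtain g where g: "g \<in> opow_carrier E" "{x. g x \<noteq> 0} \<subseteq> below E (Some e)"
      "rank_le (residual (prod_le n r)) Z (iseg (omega_pow E) (Some g))"
      by (elim bexE conjE) (rule that)
    have "opow_less E g (opow_single e 1)"
      using g(2) opow_less_single_one[OF E less.prems(1) g(1)] by (simp only: below_Some)
    moreover have "opow_single e 1 \<in> opow_carrier E"
      using less.prems(1) by (intro opow_carrier_upd) auto
    ultimately have "g \<in> below (omega_pow E) (Some (opow_single e 1))"
      using g(1) by (simp only: below_Some underS_omega_pow mem_Collect_eq simp_thms)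
    then show "\<exists>w \<in> below (omega_pow E) (Some (opow_single e 1)).
        rank_le (residual (prod_le n r)) Z (iseg (omega_pow E) (Some w))"
      using g(3) by (intro bexI[of _ g])
  qed
qed

lemma rank_le_prod_X:
  assumes E: "Well_order E" and "rank_le (dec_rel n r) (\<lambda>_. None) E"
  shows "rank_le (residual (prod_le n r)) (prod_X n r) (omega_pow E)"
proof -
  note W = Well_order_omega_pow[OF E]
  have le: "rank_le (dec_rel n r) (\<lambda>_. None) (iseg E None)" using assms(2) by simp
  have "rank_le (residual (prod_le n r)) (cyl n r (\<lambda>_. None) c) (iseg (omega_pow E) None)" for c
  proof (subst rank_le_iseg[OF W], intro allI impI)
    fix Z assume "(Z, cyl n r (\<lambda>_. None) c) \<in> residual (prod_le n r)"
    then obtain x where x: "x \<in> cyl n r (\<lambda>_. None) c"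
      and Z: "Z = {y \<in> cyl n r (\<lambda>_. None) c. \<not> prod_le n r x y \<and> \<not> prod_le n r y x}"
      by (rule residualE)
    have "\<exists>g \<in> opow_carrier E. {x. g x \<noteq> 0} \<subseteq> below E None \<and>
        rank_le (residual (prod_le n r)) Z (iseg (omega_pow E) (Some g))"
      unfolding Z by (rule rank_le_cyl_residual[OF E le x], rule rank_le_cyl[OF E]) simp_all
    then show "\<exists>w \<in> below (omega_pow E) None.
        rank_le (residual (prod_le n r)) Z (iseg (omega_pow E) (Some w))"
      by auto
  qed
  then show ?thesis by (simp add: cyl_None)
qed

section \<open>Lower bound for the width of a product\<close>

lemma rank_ge_translate:
  assumes W: "Well_order W" and ge: "rank_ge (residual (prod_le n r)) Z (iseg W e)"
    and d: "d \<in> prod_X n r" and Z: "Z \<subseteq> prod_X n r"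
    and Y: "\<And>x. x \<in> Z \<Longrightarrow> (\<lambda>i p. x i p + d i p) \<in> Y"
  shows "rank_ge (residual (prod_le n r)) Y (iseg W e)"
proof (rule rank_ge_residual_map[OF W ge, where h = "\<lambda>x i p. x i p + d i p"])
  fix x y assume xy: "x \<in> Z" "y \<in> Z" "\<not> prod_le n r x y"
  then obtain i where i: "i < n" "opow_less (r i) (y i) (x i)"
    using not_prod_leD Z by (metis subsetD)
  have "(\<lambda>i p. x i p + d i p) \<in> prod_X n r" "(\<lambda>i p. y i p + d i p) \<in> prod_X n r"
    using xy Z d by (auto intro: prod_X_add)
  then show "\<not> prod_le n r (\<lambda>i p. x i p + d i p) (\<lambda>i p. y i p + d i p)"
    using opow_less_add[OF i(2)] i(1) by (intro not_prod_leI)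
qed (rule Y)

text \<open>Each value of \<open>x i q\<close>, with nothing above \<open>q\<close>, is a level
  holding one copy of the smaller product. The top level consumes the last \<omega>^p; the levels
  below it, shifted upwards in coordinate \<open>j\<close>, realise the remaining multiple by
  induction. The position \<open>t\<close> gives the room for this shift, which is how the second
  nonzero entry enters the lower bound.\<close>

lemma rank_ge_copies:
  assumes E: "Well_order E" and p: "p \<in> Field E"
    and ij: "i < n" "j < n" "j \<noteq> i"
    and q: "q \<in> below (r i) (b i)" and t: "t \<in> below (r j) (b j)"
    and ge: "rank_ge (residual (prod_le n r)) (cyl n r (b(i := Some q)) (\<lambda>_ _. 0))
      (iseg (omega_pow E) (Some (opow_single p 1)))"
  shows "rank_ge (residual (prod_le n r))
    {x \<in> cyl n r b (\<lambda>_ _. 0). x i q < k \<and> (\<forall>y. (q, y) \<in> r i \<longrightarrow> y \<noteq> q \<longrightarrow> x i y = 0)}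
    (iseg (omega_pow E) (Some (opow_single p k)))"
proof (induction k)
  case 0
  note W = Well_order_omega_pow[OF E]
  have "underS (omega_pow E) (opow_single p 0) = {}"
    using p by (subst underS_omega_pow) (auto simp: opow_less_def intro: opow_carrier_upd)
  then show ?case by (subst rank_ge_iseg[OF W]) (simp only: below_Some ball_simps)
next
  case (Suc k)
  note W = Well_order_omega_pow[OF E]
  let ?le = "prod_le n r" and ?o = "\<lambda>_ _. 0 :: nat"
  let ?top = "\<lambda>x. \<forall>y. (q, y) \<in> r i \<longrightarrow> y \<noteq> q \<longrightarrow> x i y = (0 :: nat)"
  let ?Y = "\<lambda>k. {x \<in> cyl n r b ?o. x i q < k \<and> ?top x}"
  let ?Z = "{x \<in> cyl n r b ?o. x i q = k \<and> ?top x}"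
  have qF: "q \<in> Field (r i)" and tF: "t \<in> Field (r j)"
    using q t below_subset_Field[of "r i" "b i"] below_subset_Field[of "r j" "b j"] by auto
  \<comment> \<open>The top level is the given cylinder translated by \<open>k\<close> at position
    \<open>q\<close>.\<close>
  have Z: "rank_ge (residual ?le) ?Z (iseg (omega_pow E) (Some (opow_single p 1)))"
  proof (rule rank_ge_translate[OF W ge, where d = "?o(i := opow_single q k)"])
    show d: "?o(i := opow_single q k) \<in> prod_X n r"
      using ij(1) qF by (auto simp: prod_X_def intro: opow_carrier_upd)
    show "cyl n r (b(i := Some q)) ?o \<subseteq> prod_X n r" by (rule cyl_subset)
    fix x assume x: "x \<in> cyl n r (b(i := Some q)) ?o"
    have xX: "x \<in> prod_X n r" using x cyl_subset by blast
    have x0: "x l y = 0" if "l < n" "y \<in> Field (r l)" "y \<notin> below (r l) ((b(i := Some q)) l)" for l y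
      using x that by (auto simp: cyl_def)
    have xi: "x i y = 0" if "y \<in> Field (r i)" "y \<notin> underS (r i) q" for y
      using x0[OF ij(1), of y] that by simp
    have xq: "x i q = 0" using xi[OF qF] by (simp add: underS_def)
    have "x i y = 0" if "(q, y) \<in> r i" "y \<noteq> q" for y
      by (rule xi) (use that Well_order_antisym[OF wo[OF ij(1)]] in \<open>auto simp: underS_def Field_def\<close>)
    moreover have "x l y + (?o(i := opow_single q k)) l y = 0"
      if l: "l < n" "y \<in> Field (r l)" "y \<notin> below (r l) (b l)" for l y
    proof (cases "l = i")
      case True
      then have "y \<notin> underS (r i) q" "y \<noteq> q"
        using l(3) q underS_mono[OF wo[OF ij(1)] q] by auto
      then show ?thesis using xi True l(2) by simp
    next
      case False
      then show ?thesis using x0[OF l(1,2)] l(3) by simp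
    qed
    ultimately show "(\<lambda>l y. x l y + (?o(i := opow_single q k)) l y) \<in> ?Z"
      using prod_X_add[OF xX d] xq by (simp add: cyl_def)
  qed
  have above: "\<exists>Z0 \<subseteq> ?Y (Suc k). (\<forall>z \<in> Z0. \<forall>x \<in> F. \<not> ?le x z \<and> \<not> ?le z x) \<and>
      rank_ge (residual ?le) Z0 (iseg (omega_pow E) (Some (opow_single p k)))"
    if F: "finite F" "F \<subseteq> ?Z" for F
  proof -
    have FX: "z \<in> prod_X n r" if "z \<in> F" for z using F(2) cyl_subset that by blast
    have "\<exists>c \<in> opow_carrier (r j). (\<forall>t. t \<notin> below (r j) (b j) \<longrightarrow> c t = 0) \<and>
        (\<forall>f \<in> (\<lambda>z. z j) ` F. \<forall>t. f t \<le> c t)"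
    proof (rule opow_carrier_bound)
      fix f assume "f \<in> (\<lambda>z. z j) ` F"
      then obtain z where z: "z \<in> F" "f = z j" by blast
      have fc: "f \<in> opow_carrier (r j)" using prod_X_carrier[OF FX[OF z(1)] ij(2)] z(2) by simp
      moreover have "f y = 0" if "y \<notin> below (r j) (b j)" for y
      proof (cases "y \<in> Field (r j)")
        case True
        then show ?thesis using F(2) z ij(2) that by (auto simp: cyl_def)
      next
        case False
        then show ?thesis using opow_carrier_Field[OF fc] by blast
      qed
      ultimately show "f \<in> opow_carrier (r j) \<and> (\<forall>t. t \<notin> below (r j) (b j) \<longrightarrow> f t = 0)" by blast
    qed (use F(1) in simp)
    then obtain c where c: "c \<in> opow_carrier (r j)" "\<And>t. t \<notin> below (r j) (b j) \<Longrightarrow> c t = 0"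
      "\<And>z t. z \<in> F \<Longrightarrow> z j t \<le> c t" by auto
    \<comment> \<open>\<open>c\<close> bounds coordinate \<open>j\<close> of all elements played so
      far, and the extra unit at \<open>t\<close> makes the excess strict. Both live inside
      \<open>below (r j) (b j)\<close>, so shifted elements stay in the cylinder.\<close>
    define d where "d = ?o(j := c(t := Suc (c t)))"
    have d: "d \<in> prod_X n r"
      using c(1) tF ij(2) by (auto simp: d_def prod_X_def intro: opow_carrier_upd)
    have dj: "d j s \<ge> c s" "d j t > c t" for s by (auto simp: d_def)
    let ?h = "\<lambda>x l y. x l y + d l y"
    have YX: "?Y k \<subseteq> prod_X n r" using cyl_subset by blast
    have sub: "?h x \<in> ?Y (Suc k)" if x: "x \<in> ?Y k" for x
    proof -
      have "x l y + d l y = 0" if "l < n" "y \<in> Field (r l)" "y \<notin> below (r l) (b l)" for l y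
        using that x c(2)[of y] t by (auto simp: cyl_def d_def)
      then show ?thesis
        using x prod_X_add[OF _ d, of x] YX ij(3) by (auto simp: cyl_def d_def)
    qed
    have inc: "\<not> ?le z (?h x) \<and> \<not> ?le (?h x) z" if x: "x \<in> ?Y k" and z: "z \<in> F" for x z
    proof -
      have hX: "?h x \<in> prod_X n r" using x YX d by (intro prod_X_add) auto
      have "opow_less (r i) (?h x i) (z i)"
        unfolding opow_less_def using x z F(2) ij(3) by (intro exI[of _ q]) (auto simp: d_def)
      then have "\<not> ?le z (?h x)" using FX[OF z] hX ij(1) by (intro not_prod_leI)
      moreover have "opow_less (r j) (z j) (?h x j)"
        using prod_X_carrier[OF FX[OF z] ij(2)] prod_X_carrier[OF hX ij(2)]
      proof (rule opow_less_pointwise[OF wo[OF ij(2)]])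
        show "z j s \<le> x j s + d j s" for s
          using c(3)[OF z, of s] dj(1)[of s] by linarith
        show "z j t < x j t + d j t"
          using c(3)[OF z, of t] dj(2) by linarith
      qed
      then have "\<not> ?le (?h x) z" using FX[OF z] hX ij(2) by (intro not_prod_leI)
      ultimately show ?thesis by blast
    qed
    have "rank_ge (residual ?le) (?h ` ?Y k) (iseg (omega_pow E) (Some (opow_single p k)))"
      using Suc d YX by (rule rank_ge_translate[OF W]) (rule imageI)
    moreover have "?h ` ?Y k \<subseteq> ?Y (Suc k)" using sub by (rule image_subsetI)
    moreover have "\<forall>z \<in> ?h ` ?Y k. \<forall>x \<in> F. \<not> ?le x z \<and> \<not> ?le z x" using inc by simp
    ultimately show ?thesis by (intro exI[of _ "?h ` ?Y k"] conjI)
  qed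
  have "rank_ge (residual ?le) (?Y (Suc k))
      (iseg (omega_pow E) (Some (\<lambda>x. opow_single p k x + opow_single p 1 x)))"
  proof (rule rank_ge_residual_add[OF E p _ _ Z])
    show "opow_single p 1 \<in> opow_carrier E" using p by (intro opow_carrier_upd) auto
    show "?Z \<subseteq> ?Y (Suc k)" by auto
  qed (simp, rule above)
  moreover have "(\<lambda>x. opow_single p k x + opow_single p 1 x) = opow_single p (Suc k)" by auto
  ultimately show ?case by (simp only:)
qed

text \<open>For the leading exponent \<open>p\<close> of \<open>g\<close>, some
  \<open>dec_rel\<close> child of \<open>b\<close> has rank at least \<open>p\<close>. Enough copies
  of its product fit into the cylinder to give \<omega>^p \<cdot> k above \<open>g\<close>, so some
  move leaves at least \<open>g\<close>. For \<open>g\<close> zero there is no leading exponent, and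
  any move will do.\<close>

lemma rank_ge_cyl_residual:
  assumes E: "Well_order E" and ge: "rank_ge (dec_rel n r) b (iseg E e)"
    and g: "g \<in> opow_carrier E" "{x. g x \<noteq> 0} \<subseteq> below E e"
    and IH: "\<And>w b. w \<in> below E e \<Longrightarrow> rank_ge (dec_rel n r) b (iseg E (Some w)) \<Longrightarrow>
      rank_ge (residual (prod_le n r)) (cyl n r b (\<lambda>_ _. 0))
        (iseg (omega_pow E) (Some (opow_single w 1)))"
  shows "\<exists>Z. (Z, cyl n r b (\<lambda>_ _. 0)) \<in> residual (prod_le n r) \<and>
    rank_ge (residual (prod_le n r)) Z (iseg (omega_pow E) (Some g))"
proof (cases "g = (\<lambda>_. 0)")
  case True
  note W = Well_order_omega_pow[OF E]
  have zero: "(\<lambda>_ _. 0) \<in> cyl n r b (\<lambda>_ _. 0)" by (simp add: cyl_def prod_X_def)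
  have "underS (omega_pow E) g = {}"
    unfolding underS_omega_pow[OF g(1)] using True by (simp add: opow_less_def)
  then have ge0: "rank_ge (residual (prod_le n r)) Z (iseg (omega_pow E) (Some g))" for Z
    by (subst rank_ge_iseg[OF W]) (simp only: below_Some ball_simps)
  show ?thesis by (rule exI, rule conjI[OF residualI[OF zero] ge0])
next
  case False
  note W = Well_order_omega_pow[OF E]
  obtain p k where p: "p \<in> below E e" "p \<in> Field E" "opow_less E g (opow_single p k)"
    using opow_less_single_ex[OF E g False] by blast
  obtain b' where "(b', b) \<in> dec_rel n r" and ge': "rank_ge (dec_rel n r) b' (iseg E (Some p))"
    using rank_ge_isegD[OF E ge p(1)] by blast
  then obtain i j q where *: "i < n" "j < n" "j \<noteq> i" "q \<in> below (r i) (b i)"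
    "below (r j) (b j) \<noteq> {}" "b' = b(i := Some q)"
    by (auto simp: dec_rel_def)
  obtain t where t: "t \<in> below (r j) (b j)" using *(5) by blast
  have "rank_ge (residual (prod_le n r)) (cyl n r b (\<lambda>_ _. 0))
      (iseg (omega_pow E) (Some (opow_single p k)))"
    by (rule rank_ge_residual_mono[OF W rank_ge_copies[OF E p(2) *(1-4) t]])
      (use IH[OF p(1) ge'] *(6) in auto)
  moreover have "opow_single p k \<in> opow_carrier E" using p(2) by (intro opow_carrier_upd) auto
  then have "g \<in> below (omega_pow E) (Some (opow_single p k))"
    using g(1) p(3) by (simp only: below_Some underS_omega_pow mem_Collect_eq simp_thms)
  ultimately show ?thesis by (rule rank_ge_isegD[OF W])
qed

lemma rank_ge_cyl:
  assumes E: "Well_order E" and "e \<in> Field E" "rank_ge (dec_rel n r) b (iseg E (Some e))"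
  shows "rank_ge (residual (prod_le n r)) (cyl n r b (\<lambda>_ _. 0))
    (iseg (omega_pow E) (Some (opow_single e 1)))"
  using Well_order_wf[OF E] assms(2,3)
proof (induction e arbitrary: b rule: wf_induct_rule)
  case (less e)
  have IH: "rank_ge (residual (prod_le n r)) (cyl n r b (\<lambda>_ _. 0))
      (iseg (omega_pow E) (Some (opow_single w 1)))"
    if "w \<in> below E (Some e)" "rank_ge (dec_rel n r) b (iseg E (Some w))" for w b
    by (rule less.IH[OF _ _ that(2)]) (use that(1) in \<open>auto simp: underS_def Field_def\<close>)
  have ec: "opow_single e 1 \<in> opow_carrier E" using less.prems(1) by (intro opow_carrier_upd) auto
  show ?case
  proof (subst rank_ge_iseg[OF Well_order_omega_pow[OF E]], intro ballI)
    fix g assume "g \<in> below (omega_pow E) (Some (opow_single e 1))"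
    then have g: "g \<in> opow_carrier E" "opow_less E g (opow_single e 1)"
      using ec by (simp_all only: below_Some underS_omega_pow mem_Collect_eq)
    have supp: "{x. g x \<noteq> 0} \<subseteq> below E (Some e)"
      using g(2) opow_less_single_one[OF E less.prems(1) g(1)] by (simp only: below_Some)
    show "\<exists>Z. (Z, cyl n r b (\<lambda>_ _. 0)) \<in> residual (prod_le n r) \<and>
        rank_ge (residual (prod_le n r)) Z (iseg (omega_pow E) (Some g))"
      by (rule rank_ge_cyl_residual[OF E less.prems(2) g(1) supp]) (rule IH)
  qed
qed

lemma rank_ge_prod_X:
  assumes E: "Well_order E" and "rank_ge (dec_rel n r) (\<lambda>_. None) E"
  shows "rank_ge (residual (prod_le n r)) (prod_X n r) (omega_pow E)"
proof -
  have ge: "rank_ge (dec_rel n r) (\<lambda>_. None) (iseg E None)" using assms(2) by simp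
  have "rank_ge (residual (prod_le n r)) (cyl n r (\<lambda>_. None) (\<lambda>_ _. 0)) (iseg (omega_pow E) None)"
  proof (subst rank_ge_iseg[OF Well_order_omega_pow[OF E]], intro ballI)
    fix g assume "g \<in> below (omega_pow E) None"
    then have g: "g \<in> opow_carrier E" by simp
    then have supp: "{x. g x \<noteq> 0} \<subseteq> below E None" using opow_carrier_Field by fastforce
    show "\<exists>Z. (Z, cyl n r (\<lambda>_. None) (\<lambda>_ _. 0)) \<in> residual (prod_le n r) \<and>
        rank_ge (residual (prod_le n r)) Z (iseg (omega_pow E) (Some g))"
      by (rule rank_ge_cyl_residual[OF E ge g supp], rule rank_ge_cyl[OF E]) simp_all
  qed
  then show ?thesis by (simp add: cyl_None)
qed

lemma width_prod_X:
  assumes "rank_is (dec_rel n r) (\<lambda>_. None) E"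
  shows "width_is (prod_X n r) (prod_le n r) (omega_pow E)"
  using assms Well_order_omega_pow rank_le_prod_X rank_ge_prod_X
  unfolding rank_is_def by (intro width_isI) auto

end

section \<open>The exponent\<close>

lemma le_opt_below_iff:
  "le_opt A u v \<Longrightarrow> u = v \<or> (\<exists>a \<in> below A v. u = Some a)"
  by (cases u; cases v) (auto simp: le_opt_def underS_def)

lemma le_opt_Some: "a \<in> below A v \<Longrightarrow> le_opt A (Some a) v"
  by (cases v) (auto simp: le_opt_def underS_def Field_def)

lemma le_opt_refl: "Well_order A \<Longrightarrow> le_opt A v None \<Longrightarrow> le_opt A v v"
  by (cases v) (auto simp: le_opt_def Well_order_refl)

lemma le_opt_below_mono: "Well_order A \<Longrightarrow> le_opt A u v \<Longrightarrow> below A u \<subseteq> below A v"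
  using le_opt_below_iff underS_mono by fastforce

lemma natsum2_relE:
  assumes "(x, (a, s)) \<in> natsum2_rel A B"
  obtains a' s' where "x = (a', s')" "(a', s') \<noteq> (a, s)" "le_opt A a' a" "le_opt B s' s"
  using assms by (auto simp: natsum2_rel_def)

lemma natsum_relE:
  assumes "(u, v) \<in> natsum_rel r I"
  obtains l q where "l \<in> I" "q \<in> below (r l) (v l)" "u l = Some q"
    "\<And>i. i \<in> I \<Longrightarrow> le_opt (r i) (u i) (v i)" "\<And>i. i \<notin> I \<Longrightarrow> u i = None \<and> v i = None"
proof -
  have u: "\<And>i. i \<in> I \<Longrightarrow> le_opt (r i) (u i) (v i)" "\<And>i. i \<notin> I \<Longrightarrow> u i = None \<and> v i = None" "u \<noteq> v"
    using assms by (auto simp: natsum_rel_def)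
  then obtain l where l: "u l \<noteq> v l" by blast
  then have "l \<in> I" using u(2) by fastforce
  then show ?thesis using that l u le_opt_below_iff by metis
qed

text \<open>Distinct positions below \<open>e\<close> have different numbers of predecessors, and by
  induction each of these numbers is less than \<open>N x\<close>.\<close>

lemma rank_ge_card_bound:
  fixes N :: "'n \<Rightarrow> nat"
  assumes W: "Well_order W" and N: "\<And>x y. (y, x) \<in> R \<Longrightarrow> N y < N x"
    and "rank_ge R x (iseg W e)"
  shows "finite (below W e) \<and> card (below W e) \<le> N x"
  using W assms(3)
proof (induction e arbitrary: x rule: below_induct)
  case (below e)
  have *: "finite (underS W w) \<and> card (underS W w) < N x" if w: "w \<in> below W e" for w
  proof -
    obtain y where y: "(y, x) \<in> R" "rank_ge R y (iseg W (Some w))"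
      using rank_ge_isegD[OF W below.prems w] by blast
    then show ?thesis using below.IH[OF w y(2)] N[OF y(1)] by simp
  qed
  have "inj_on (\<lambda>w. card (underS W w)) (below W e)"
  proof (rule inj_onI, rule ccontr)
    fix v w
    assume vw: "v \<in> below W e" "w \<in> below W e" "card (underS W v) = card (underS W w)" "v \<noteq> w"
    have less: "card (underS W a) < card (underS W b)"
      if "b \<in> below W e" "a \<in> underS W b" for a b
      using *[OF that(1)] underS_mono[OF W, of a "Some b"] that(2)
      by (intro psubset_card_mono) (auto simp: underS_def)
    have "v \<in> underS W w \<or> w \<in> underS W v"
      using vw below_subset_Field[of W e] Well_order_total[OF W, of v w] by (auto simp: underS_def)
    then show False using less vw by fastforce
  qed
  moreover have "(\<lambda>w. card (underS W w)) ` below W e \<subseteq> {..<N x}" using * by auto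
  ultimately show ?case
    using card_inj_on_le[of _ _ "{..<N x}"] inj_on_finite[of _ _ "{..<N x}"] by auto
qed

section \<open>Lower bound for the rank of \<open>dec_rel\<close>\<close>

text \<open>A halfway house between the natural sum and \<open>dec_rel\<close>: only one entry
  changes per move, but no second nonzero entry is asked for.\<close>

definition sdec_rel ::
  "nat \<Rightarrow> (nat \<Rightarrow> 'a rel) \<Rightarrow> ((nat \<Rightarrow> 'a option) \<times> (nat \<Rightarrow> 'a option)) set" where
  "sdec_rel n r = {(b(i := Some q), b) | b i q. i < n \<and> q \<in> below (r i) (b i)}"

lemma sdec_relI: "i < n \<Longrightarrow> q \<in> below (r i) (b i) \<Longrightarrow> (b(i := Some q), b) \<in> sdec_rel n r"
  by (auto simp: sdec_rel_def)

lemma sdec_relE: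
  assumes "(b', b) \<in> sdec_rel n r"
  obtains i q where "i < n" "q \<in> below (r i) (b i)" "b' = b(i := Some q)"
  using assms by (auto simp: sdec_rel_def)

lemma dec_relI:
  "i < n \<Longrightarrow> j < n \<Longrightarrow> j \<noteq> i \<Longrightarrow> q \<in> below (r i) (b i) \<Longrightarrow> below (r j) (b j) \<noteq> {} \<Longrightarrow>
    (b(i := Some q), b) \<in> dec_rel n r"
  by (auto simp: dec_rel_def)

lemma dec_relE:
  assumes "(b', b) \<in> dec_rel n r"
  obtains i j q where "i < n" "j < n" "j \<noteq> i" "q \<in> below (r i) (b i)" "below (r j) (b j) \<noteq> {}"
    "b' = b(i := Some q)"
  using assms by (auto simp: dec_rel_def)

lemma rank_ge_sdec_mono:
  assumes E: "Well_order E" and ge: "rank_ge (sdec_rel n r) b (iseg E e)"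
    and sub: "\<And>i. i < n \<Longrightarrow> below (r i) (b i) \<subseteq> below (r i) (b' i)"
  shows "rank_ge (sdec_rel n r) b' (iseg E e)"
proof -
  define P where "P b' e \<longleftrightarrow> (\<exists>b. rank_ge (sdec_rel n r) b (iseg E e) \<and>
    (\<forall>i < n. below (r i) (b i) \<subseteq> below (r i) (b' i)))" for b' e
  have init: "P b' e" unfolding P_def using ge sub by (intro exI[of _ b]) simp
  have step: "\<exists>b''. (b'', b') \<in> sdec_rel n r \<and> P b'' (Some w)"
    if P: "P b' e" and w: "w \<in> below E e" for b' e w
  proof -
    obtain b where b: "rank_ge (sdec_rel n r) b (iseg E e)"
      "\<forall>i < n. below (r i) (b i) \<subseteq> below (r i) (b' i)"
      using P unfolding P_def by (elim exE conjE) (rule that)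
    obtain c where c: "(c, b) \<in> sdec_rel n r" "rank_ge (sdec_rel n r) c (iseg E (Some w))"
      using rank_ge_isegD[OF E b(1) w] by (elim exE conjE) (rule that)
    obtain i q where i: "i < n" "q \<in> below (r i) (b i)" "c = b(i := Some q)"
      using c(1) by (rule sdec_relE)
    have "(b'(i := Some q), b') \<in> sdec_rel n r" using i(1,2) b(2) by (intro sdec_relI) auto
    moreover have "P (b'(i := Some q)) (Some w)"
      unfolding P_def using c(2) b(2) i(3) by (intro exI[of _ c]) simp
    ultimately show ?thesis by (intro exI conjI)
  qed
  show ?thesis using E init step by (rule rank_ge_sim)
qed

text \<open>A natural-sum move may lower several entries at once. The real tuple lowers just one of
  them and stays entrywise above a ghost tuple \<open>c\<close> that makes the full move. The second
  summand is counted in \<open>S'\<close>, while the rank of the tail is known along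
  \<open>S\<close>; \<open>h\<close> translates. Entry 0 is reset to \<open>None\<close> because
  \<open>natsum_rel\<close> pins all entries outside its index set.\<close>

lemma rank_ge_sdec_natsum:
  fixes h :: "'c option \<Rightarrow> 'b option"
  assumes n: "0 < n" and wo: "\<And>i. i < n \<Longrightarrow> Well_order (r i)"
    and S: "Well_order S" and E: "Well_order E"
    and h: "\<And>s b. b \<in> below S' s \<Longrightarrow> \<exists>w \<in> below S (h s). h (Some b) = Some w"
    and ge2: "rank_ge (natsum2_rel (r 0) S') (b 0, s) (iseg E e)"
    and ge: "rank_ge (natsum_rel r {1..<n}) (b(0 := None)) (iseg S (h s))"
  shows "rank_ge (sdec_rel n r) b (iseg E e)"
proof -
  define P where "P b e \<longleftrightarrow> (\<exists>c s. rank_ge (natsum2_rel (r 0) S') (c 0, s) (iseg E e) \<and>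
    rank_ge (natsum_rel r {1..<n}) (c(0 := None)) (iseg S (h s)) \<and>
    (\<forall>i < n. below (r i) (c i) \<subseteq> below (r i) (b i)))" for b e
  have init: "P b e" unfolding P_def using ge ge2 by (intro exI[of _ b] exI[of _ s]) simp
  have step: "\<exists>b'. (b', b) \<in> sdec_rel n r \<and> P b' (Some w)"
    if P: "P b e" and w: "w \<in> below E e" for b e w
  proof -
    obtain c s where c: "rank_ge (natsum2_rel (r 0) S') (c 0, s) (iseg E e)"
      "rank_ge (natsum_rel r {1..<n}) (c(0 := None)) (iseg S (h s))"
      "\<forall>i < n. below (r i) (c i) \<subseteq> below (r i) (b i)"
      using P unfolding P_def by (elim exE conjE) (rule that)
    obtain x where x: "(x, (c 0, s)) \<in> natsum2_rel (r 0) S'"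
      "rank_ge (natsum2_rel (r 0) S') x (iseg E (Some w))"
      using rank_ge_isegD[OF E c(1) w] by (elim exE conjE) (rule that)
    obtain a' s' where a': "x = (a', s')" "(a', s') \<noteq> (c 0, s)" "le_opt (r 0) a' (c 0)"
      "le_opt S' s' s"
      using x(1) by (rule natsum2_relE)
    show ?thesis
    proof (cases "s' = s")
      case True
      then obtain q where q: "q \<in> below (r 0) (c 0)" "a' = Some q"
        using a'(2) le_opt_below_iff[OF a'(3)] by auto
      have "(b(0 := Some q), b) \<in> sdec_rel n r" using n q(1) c(3) by (intro sdec_relI) auto
      moreover have "P (b(0 := Some q)) (Some w)"
        unfolding P_def using x(2) a'(1) q(2) True c(2,3)
        by (intro exI[of _ "c(0 := Some q)"] exI[of _ s]) simp
      ultimately show ?thesis by (intro exI conjI)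
    next
      case False
      then obtain t where t: "t \<in> below S' s" "s' = Some t" using le_opt_below_iff[OF a'(4)] by auto
      obtain v where v: "v \<in> below S (h s)" "h (Some t) = Some v" using h[OF t(1)] by blast
      obtain u where u: "(u, c(0 := None)) \<in> natsum_rel r {1..<n}"
        "rank_ge (natsum_rel r {1..<n}) u (iseg S (Some v))"
        using rank_ge_isegD[OF S c(2) v(1)] by (elim exE conjE) (rule that)
      obtain l q where l: "l \<in> {1..<n}" "q \<in> below (r l) ((c(0 := None)) l)" "u l = Some q"
        and le: "\<And>i. i \<in> {1..<n} \<Longrightarrow> le_opt (r i) (u i) ((c(0 := None)) i)"
        and out: "\<And>i. i \<notin> {1..<n} \<Longrightarrow> u i = None \<and> (c(0 := None)) i = None"
        using u(1) by (rule natsum_relE) (rule that)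
      have ln: "l < n" "l \<noteq> 0" using l(1) by auto
      have "(b(l := Some q), b) \<in> sdec_rel n r" using l(2) ln c(3) by (intro sdec_relI) auto
      moreover have "below (r i) ((u(0 := a')) i) \<subseteq> below (r i) ((b(l := Some q)) i)"
        if i: "i < n" for i
      proof (cases "i = 0")
        case True
        then show ?thesis
          using le_opt_below_mono[OF wo[OF n] a'(3)] c(3) n ln by auto
      next
        case False
        show ?thesis
        proof (cases "i = l")
          case True
          then show ?thesis using l(3) ln by simp
        next
          case False
          have "below (r i) (u i) \<subseteq> below (r i) (c i)"
            using le_opt_below_mono[OF wo[OF i] le[of i]] \<open>i \<noteq> 0\<close> i by simp
          then show ?thesis using c(3) i False \<open>i \<noteq> 0\<close> by auto
        qed
      qed
      moreover have "u(0 := None) = u" using out[of 0] by auto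
      ultimately have "(b(l := Some q), b) \<in> sdec_rel n r" "P (b(l := Some q)) (Some w)"
        unfolding P_def using x(2) a'(1) t(2) u(2) v(2)
        by - (assumption, intro exI[of _ "u(0 := a')"] exI[of _ s'], simp)
      then show ?thesis by (intro exI conjI)
    qed
  qed
  show ?thesis using E init step by (rule rank_ge_sim)
qed

text \<open>The natural sum of a tuple with two nonzero entries exceeds its \<^const>\<open>dec_rel\<close> rank by at
  most one, and does not exceed it if two entries are infinite.\<close>

lemma rank_ge_dec_rel:
  assumes wo: "\<And>i. i < n \<Longrightarrow> Well_order (r i)" and E: "Well_order E"
    and ab: "a < n" "a' < n" "a \<noteq> a'" "below (r a) (b a) \<noteq> {}" "below (r a') (b a') \<noteq> {}"
    and ge: "(\<exists>i < n. \<exists>q \<in> below (r i) (b i). rank_ge (sdec_rel n r) (b(i := Some q)) (iseg E e)) \<or>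
      rank_ge (sdec_rel n r) b (iseg E e) \<and>
        infinite (below (r a) (b a)) \<and> infinite (below (r a') (b a'))"
  shows "rank_ge (dec_rel n r) b (iseg E e)"
proof -
  let ?GE = "\<lambda>b e. rank_ge (sdec_rel n r) b (iseg E e)"
  let ?nz = "\<lambda>b i. below (r i) (b i) \<noteq> {}" and ?inf = "\<lambda>b i. infinite (below (r i) (b i))"
  \<comment> \<open>\<open>L1\<close> keeps one unit in reserve: the rank \<open>e\<close> is
    already available at an \<open>sdec_rel\<close> child of \<open>b\<close>. \<open>L2\<close> has
    no reserve, but two infinite entries from which one can be made. The last alternative in
    \<open>L\<close> is rank zero, where nothing is left to show.\<close>
  define L1 where "L1 b e \<longleftrightarrow> (\<exists>i < n. \<exists>q \<in> below (r i) (b i). ?GE (b(i := Some q)) e) \<and>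
    (\<exists>i < n. \<exists>j < n. i \<noteq> j \<and> ?nz b i \<and> ?nz b j)" for b e
  define L2 where "L2 b e \<longleftrightarrow> ?GE b e \<and> (\<exists>i < n. \<exists>j < n. i \<noteq> j \<and> ?inf b i \<and> ?inf b j)" for b e
  define L where "L b e \<longleftrightarrow> L1 b e \<or> L2 b e \<or> below E e = {}" for b e
  have L1I: "L1 b e" if "i < n" "q \<in> below (r i) (b i)" "?GE (b(i := Some q)) e"
    "k < n" "l < n" "k \<noteq> l" "?nz b k" "?nz b l" for b e i q k l
    unfolding L1_def using that(1,2,3) that(4-8) by (intro conjI exI bexI)
  have L2I: "L2 b e" if "?GE b e" "k < n" "l < n" "k \<noteq> l" "?inf b k" "?inf b l" for b e k l
    unfolding L2_def using that by (intro conjI exI)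
  have init: "L b e"
    using ge
  proof (elim disjE bexE exE conjE)
    fix i q assume "i < n" "q \<in> below (r i) (b i)" "?GE (b(i := Some q)) e"
    then have "L1 b e" using ab by (rule L1I)
    then show ?thesis by (simp add: L_def)
  next
    assume "?GE b e" "?inf b a" "?inf b a'"
    then have "L2 b e" using ab by (intro L2I[of b e a a'])
    then show ?thesis by (simp add: L_def)
  qed
  have step1: "\<exists>b'. (b', b) \<in> dec_rel n r \<and> L b' (Some p)"
    if L: "L1 b e" and p: "p \<in> below E e" for b e p
  proof -
    obtain i q where i: "i < n" "q \<in> below (r i) (b i)" "?GE (b(i := Some q)) e"
      using L unfolding L1_def by (elim bexE exE conjE) (rule that)
    obtain k l where kl: "k < n" "l < n" "k \<noteq> l" "?nz b k" "?nz b l"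
      using L unfolding L1_def by (elim exE conjE) (rule that)
    obtain j where j: "j < n" "j \<noteq> i" "?nz b j" using kl by (cases "k = i") auto
    let ?b = "b(i := Some q)"
    obtain c where c: "(c, ?b) \<in> sdec_rel n r" "?GE c (Some p)"
      using rank_ge_isegD[OF E i(3) p] by (elim exE conjE) (rule that)
    obtain i' q' where i': "i' < n" "q' \<in> below (r i') (?b i')" "c = ?b(i' := Some q')"
      using c(1) by (rule sdec_relE)
    have dec: "(?b, b) \<in> dec_rel n r" using i j by (intro dec_relI)
    show ?thesis
    proof (cases "\<exists>k < n. \<exists>l < n. k \<noteq> l \<and> ?nz ?b k \<and> ?nz ?b l")
      case True
      then obtain k l where "k < n" "l < n" "k \<noteq> l" "?nz ?b k" "?nz ?b l"
        by (elim exE conjE) (rule that)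
      with i'(1,2) c(2)[unfolded i'(3)] have "L1 ?b (Some p)" by (rule L1I)
      then have "L ?b (Some p)" by (simp add: L_def)
      with dec show ?thesis by (intro exI conjI)
    next
      case False
      have "i' \<noteq> i"
      proof
        assume "i' = i"
        then have "?nz ?b i" "?nz ?b j" using i'(2) j by auto
        then show False using False i(1) j by blast
      qed
      then have q': "q' \<in> below (r i') (b i')" using i'(2) by simp
      \<comment> \<open>Lowering entry \<open>i\<close> now would leave \<open>i'\<close> as the
        only nonzero entry, a dead end for \<open>dec_rel\<close>. The two decrements commute, so
        the one at \<open>i'\<close> is made first and the one at \<open>i\<close> becomes the new
        reserve.\<close>
      let ?c = "b(i' := Some q')"
      have nzi: "?nz ?c i" using i(2) \<open>i' \<noteq> i\<close> by auto
      have dec': "(?c, b) \<in> dec_rel n r" using i'(1) i(1,2) \<open>i' \<noteq> i\<close> q' by (intro dec_relI[of i' n i]) auto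
      have comm: "?c(i := Some q) = c" using i'(3) \<open>i' \<noteq> i\<close> by (simp add: fun_upd_twist)
      have "L ?c (Some p)"
      proof (cases "underS (r i') q' = {}")
        case True
        \<comment> \<open>With \<open>q'\<close> zero as well, \<open>c\<close> is the zero tuple,
          which forces \<open>p\<close> to be zero.\<close>
        have "below (r k) (c k) = {}" if k: "k < n" for k
        proof (cases "k = i'")
          case True
          then show ?thesis using \<open>underS (r i') q' = {}\<close> i'(3) by simp
        next
          case False
          then have "\<not> ?nz ?b k" using \<open>\<not> (\<exists>k < n. \<exists>l < n. k \<noteq> l \<and> ?nz ?b k \<and> ?nz ?b l)\<close> k i' by blast
          then show ?thesis using False i'(3) by simp
        qed
        then have "\<nexists>d. (d, c) \<in> sdec_rel n r" by (auto elim!: sdec_relE)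
        then have "below E (Some p) = {}" using rank_ge_isegD[OF E c(2)] by blast
        then show ?thesis by (simp add: L_def)
      next
        case False
        have "L1 ?c (Some p)"
          using i(1) _ _ i(1) i'(1) \<open>i' \<noteq> i\<close>[symmetric] nzi
        proof (rule L1I)
          show "q \<in> below (r i) (?c i)" using i(2) \<open>i' \<noteq> i\<close> by simp
          show "?GE (?c(i := Some q)) (Some p)" unfolding comm by (rule c(2))
          show "?nz ?c i'" using False by simp
        qed
        then show ?thesis by (simp add: L_def)
      qed
      with dec' show ?thesis by (intro exI conjI)
    qed
  qed
  have step2: "\<exists>b'. (b', b) \<in> dec_rel n r \<and> L b' (Some p)"
    if L: "L2 b e" and p: "p \<in> below E e" for b e p
  proof -
    obtain k l where kl: "k < n" "l < n" "k \<noteq> l" "?inf b k" "?inf b l" and GE: "?GE b e"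
      using L unfolding L2_def by (elim exE conjE) (rule that)
    obtain c where c: "(c, b) \<in> sdec_rel n r" "?GE c (Some p)"
      using rank_ge_isegD[OF E GE p] by (elim exE conjE) (rule that)
    obtain i q where i: "i < n" "q \<in> below (r i) (b i)" "c = b(i := Some q)"
      using c(1) by (rule sdec_relE)
    obtain j where j: "j < n" "j \<noteq> i" "?inf b j" using kl by (cases "k = i") auto
    have nzj: "?nz b j" using j(3) by auto
    show ?thesis
    proof (cases "\<exists>k < n. \<exists>l < n. k \<noteq> l \<and> ?inf c k \<and> ?inf c l")
      case True
      then obtain k l where "k < n" "l < n" "k \<noteq> l" "?inf c k" "?inf c l"
        by (elim exE conjE) (rule that)
      with c(2) have "L2 c (Some p)" by (rule L2I)
      then have "L c (Some p)" by (simp add: L_def)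
      moreover have "(c, b) \<in> dec_rel n r" unfolding i(3) using i j nzj by (intro dec_relI)
      ultimately show ?thesis by (intro exI conjI)
    next
      case False
      have "?inf c j" using j i(3) by simp
      then have fin: "finite (underS (r i) q)" using False i(1,3) j(1,2) by fastforce
      have infi: "?inf b i"
      proof
        assume "finite (below (r i) (b i))"
        then have "k \<noteq> i" "l \<noteq> i" using kl by auto
        then show False using False kl i(3) by fastforce
      qed
      \<comment> \<open>The move to \<open>q\<close> would make an infinite entry finite. Only
        finitely many positions are at or below \<open>q\<close>, so some \<open>t\<close> lies
        strictly between \<open>q\<close> and the entry; stopping at \<open>t\<close> leaves the
        move to \<open>q\<close> as the reserve for \<open>L1\<close>.\<close>
      have "infinite (below (r i) (b i) - insert q (underS (r i) q))"
        using infi fin by simp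
      then obtain t where t: "t \<in> below (r i) (b i)" "t \<noteq> q" "t \<notin> underS (r i) q"
        by (metis DiffE all_not_in_conv finite.emptyI insertCI)
      have qt: "q \<in> underS (r i) t"
        using t i(2) below_subset_Field[of "r i" "b i"] Well_order_total[OF wo[OF i(1)], of q t]
        by (auto simp: underS_def)
      let ?c = "b(i := Some t)"
      have "L1 ?c (Some p)"
        using i(1) _ _ i(1) j(1) j(2)[symmetric]
      proof (rule L1I)
        show "q \<in> below (r i) (?c i)" using qt by simp
        show "?GE (?c(i := Some q)) (Some p)" using c(2) i(3) by simp
        show "?nz ?c i" using qt by auto
        show "?nz ?c j" using nzj j(2) by simp
      qed
      then have "L ?c (Some p)" by (simp add: L_def)
      moreover have "(?c, b) \<in> dec_rel n r" using i(1) j t(1) nzj by (intro dec_relI)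
      ultimately show ?thesis by (intro exI conjI)
    qed
  qed
  have step: "\<exists>b'. (b', b) \<in> dec_rel n r \<and> L b' (Some p)"
    if L: "L b e" and p: "p \<in> below E e" for b e p
    using L[unfolded L_def]
  proof (elim disjE)
    assume "L1 b e"
    then show ?thesis using p by (rule step1)
  next
    assume "L2 b e"
    then show ?thesis using p by (rule step2)
  next
    assume "below E e = {}"
    then show ?thesis using p by simp
  qed
  show ?thesis using E init step by (rule rank_ge_sim)
qed

section \<open>Upper bound for the rank of \<open>dec_rel\<close>\<close>

text \<open>Here \<open>z\<close> is the zero of \<open>S\<close> and \<open>h\<close> is the shift
  of \<open>b\<close> to 1 + b. While some entry from 1 on is nonzero, the natural sum of this tail
  is kept at most 1 + s, and \<open>e\<close> at least the natural sum of entry 0 and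
  \<open>s\<close>. The move that empties the tail needs no drop of \<open>s\<close>: afterwards at
  most entry 0 is nonzero and the play is over. This is the unit saved.\<close>

lemma rank_le_dec_rel_natsum:
  fixes h :: "'c \<Rightarrow> 'b" and z :: 'b
  assumes n: "2 \<le> n" and wo: "\<And>i. i < n \<Longrightarrow> Well_order (r i)"
    and ne: "\<And>i. i < n \<Longrightarrow> Field (r i) \<noteq> {}"
    and S: "Well_order S" and S': "Well_order S'" and E: "Well_order E"
    and z: "underS S z = {}"
    and h: "\<And>s w. le_opt S' s None \<Longrightarrow> w \<in> below S (map_option h s) \<Longrightarrow>
      w = z \<or> (\<exists>b \<in> below S' s. w = h b)"
    and le2: "rank_le (natsum2_rel (r 0) S') (None, None) E"
    and le: "rank_le (natsum_rel r {1..<n}) (\<lambda>_. None) S"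
  shows "rank_le (dec_rel n r) (\<lambda>_. None) E"
proof -
  let ?nz = "\<lambda>b i. below (r i) (b i) \<noteq> {}"
  define P1 where "P1 b s e \<longleftrightarrow> (\<forall>i. i \<ge> n \<longrightarrow> b i = None) \<and> (\<forall>i < n. le_opt (r i) (b i) None) \<and>
    le_opt S' s None \<and> rank_le (natsum2_rel (r 0) S') (b 0, s) (iseg E e) \<and>
    rank_le (natsum_rel r {1..<n}) (b(0 := None)) (iseg S (map_option h s)) \<and>
    (\<exists>i \<in> {1..<n}. ?nz b i)" for b s e
  define P where "P b e \<longleftrightarrow> (\<exists>s. P1 b s e) \<or> (\<forall>i \<in> {1..<n}. \<not> ?nz b i)" for b e
  have "P1 (\<lambda>_. None) None None"
    unfolding P1_def using n ne[of 1] le le2 by (auto simp: le_opt_def fun_upd_idem)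
  then have init: "P (\<lambda>_. None) None" unfolding P_def by (intro disjI1 exI)
  have step: "\<exists>w \<in> below E e. P b' (Some w)"
    if P: "P b e" and dec: "(b', b) \<in> dec_rel n r" for b e b'
  proof -
    obtain i j q where i: "i < n" "j < n" "j \<noteq> i" "q \<in> below (r i) (b i)" "?nz b j"
      "b' = b(i := Some q)"
      using dec by (rule dec_relE)
    have qF: "q \<in> Field (r i)" using i(4) below_subset_Field[of "r i" "b i"] by blast
    have "\<not> (\<forall>i \<in> {1..<n}. \<not> ?nz b i)"
    proof
      assume "\<forall>i \<in> {1..<n}. \<not> ?nz b i"
      then have "i = 0" "j = 0"
        using i(1,2,4,5) by (metis atLeastLessThan_iff empty_iff less_one linorder_not_less)+
      then show False using i(3) by simp
    qed
    then obtain s where "P1 b s e" using P unfolding P_def by blast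
    then have out: "\<forall>i. i \<ge> n \<longrightarrow> b i = None" and val: "\<forall>i < n. le_opt (r i) (b i) None"
      and s: "le_opt S' s None" and le2: "rank_le (natsum2_rel (r 0) S') (b 0, s) (iseg E e)"
      and le: "rank_le (natsum_rel r {1..<n}) (b(0 := None)) (iseg S (map_option h s))"
      and nz: "\<exists>i \<in> {1..<n}. ?nz b i"
      unfolding P1_def by blast+
    have out': "\<forall>i. i \<ge> n \<longrightarrow> b' i = None" using out i(1,6) by simp
    have val': "\<forall>i < n. le_opt (r i) (b' i) None" using val qF i(6) by (simp add: le_opt_def)
    have child0: "\<exists>w \<in> below E e. rank_le (natsum2_rel (r 0) S') (Some a, s) (iseg E (Some w))"
      if "a \<in> below (r 0) (b 0)" for a
    proof (rule rank_le_isegD[OF E le2])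
      have "le_opt (r 0) (b 0) None" using val n by auto
      then show "((Some a, s), (b 0, s)) \<in> natsum2_rel (r 0) S'"
        using that s le_opt_refl[OF S' s] le_opt_Some[OF that]
        by (cases "b 0") (auto simp: natsum2_rel_def underS_def)
    qed
    have childS: "\<exists>w \<in> below E e. rank_le (natsum2_rel (r 0) S') (b 0, Some t) (iseg E (Some w))"
      if "t \<in> below S' s" for t
    proof (rule rank_le_isegD[OF E le2])
      have "le_opt (r 0) (b 0) None" "0 < n" using val n by auto
      then show "((b 0, Some t), (b 0, s)) \<in> natsum2_rel (r 0) S'"
        using that s le_opt_refl[OF wo[of 0]] le_opt_Some[OF that]
        by (cases s) (auto simp: natsum2_rel_def underS_def)
    qed
    have childU: "(u(l := Some a), u) \<in> natsum_rel r {1..<n}"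
      if "l \<in> {1..<n}" "a \<in> below (r l) (u l)" "\<forall>i \<in> {1..<n}. le_opt (r i) (u i) None"
        "\<forall>i. i \<notin> {1..<n} \<longrightarrow> u i = None" for l a u
    proof -
      have "u(l := Some a) \<noteq> u"
      proof
        assume "u(l := Some a) = u"
        then have "u l = Some a" by (metis fun_upd_same)
        then show False using that(2) by (simp add: underS_def)
      qed
      moreover have "le_opt (r i) ((u(l := Some a)) i) (u i)" if "i \<in> {1..<n}" for i
        using le_opt_Some[of a "r i" "u i"] le_opt_refl[OF wo] \<open>a \<in> below (r l) (u l)\<close>
          \<open>\<forall>i \<in> {1..<n}. le_opt (r i) (u i) None\<close> that by auto
      ultimately show ?thesis using that by (auto simp: natsum_rel_def)
    qed
    show ?thesis
    proof (cases "i = 0")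
      case True
      then obtain w where w: "w \<in> below E e"
        "rank_le (natsum2_rel (r 0) S') (Some q, s) (iseg E (Some w))"
        using child0[of q] i(4) by blast
      have "P1 b' s (Some w)"
        unfolding P1_def using out' val' s w(2) le nz i(6) True by simp
      then have "P b' (Some w)" unfolding P_def by (intro disjI1 exI)
      then show ?thesis using w(1) by (rule bexI)
    next
      case False
      then have iI: "i \<in> {1..<n}" using i(1) by simp
      have b'0: "b' 0 = b 0" using i(6) False by simp
      show ?thesis
      proof (cases "\<exists>l \<in> {1..<n}. ?nz b' l")
        case True
        let ?u = "b(0 := None)" and ?u' = "b'(0 := None)"
        have "(?u(i := Some q), ?u) \<in> natsum_rel r {1..<n}"
          by (rule childU[OF iI]) (use i(4) False val out in auto)
        moreover have "?u(i := Some q) = ?u'" using i(6) False by (simp add: fun_upd_twist)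
        ultimately obtain v where v: "v \<in> below S (map_option h s)"
          "rank_le (natsum_rel r {1..<n}) ?u' (iseg S (Some v))"
          using rank_le_isegD[OF S le] by metis
        obtain l a where l: "l \<in> {1..<n}" "a \<in> below (r l) (b' l)" using True by blast
        have "(?u'(l := Some a), ?u') \<in> natsum_rel r {1..<n}"
          by (rule childU[OF l(1)]) (use l val' out' in auto)
        then have "below S (Some v) \<noteq> {}" using rank_le_isegD[OF S v(2)] by blast
        \<comment> \<open>The tail can still move, so its bound \<open>v\<close> is not zero and has
          the form 1 + t with \<open>t\<close> below \<open>s\<close>.\<close>
        then have "v \<noteq> z" using z by auto
        then obtain t where t: "t \<in> below S' s" "v = h t" using h[OF s v(1)] by blast
        obtain w where w: "w \<in> below E e"
          "rank_le (natsum2_rel (r 0) S') (b 0, Some t) (iseg E (Some w))"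
          using childS[OF t(1)] by blast
        have "le_opt S' (Some t) None"
          using t(1) below_subset_Field[of S' s] by (auto simp: le_opt_def)
        then have "P1 b' (Some t) (Some w)"
          unfolding P1_def using out' val' w(2) v(2) t(2) b'0 True by simp
        then have "P b' (Some w)" unfolding P_def by (intro disjI1 exI)
        then show ?thesis using w(1) by (rule bexI)
      next
        case none: False
        \<comment> \<open>The tail has just vanished, so the nonzero entry that permitted the move
          is entry 0. It shows that \<open>e\<close> is not zero; the new tuple is terminal, so any
          \<open>w\<close> below \<open>e\<close> is good enough.\<close>
        have "j = 0"
        proof (rule ccontr)
          assume "j \<noteq> 0"
          then have "j \<in> {1..<n}" "?nz b' j" using i by auto
          then show False using none by blast
        qed
        then obtain a where "a \<in> below (r 0) (b 0)" using i(5) by blast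
        then obtain w where "w \<in> below E e" using child0 by blast
        moreover have "P b' (Some w)" unfolding P_def using none by blast
        ultimately show ?thesis by (rule bexI[rotated])
      qed
    qed
  qed
  have "rank_le (dec_rel n r) (\<lambda>_. None) (iseg E None)" using E init step by (rule rank_le_sim[where P = P])
  then show ?thesis by simp
qed

section \<open>Left subtraction of one, and the rank of \<open>dec_rel\<close>\<close>

lemma Field_one_plus: "Field (one_plus D) = insert None (Some ` Field D)"
proof
  show "Field (one_plus D) \<subseteq> insert None (Some ` Field D)"
    by (auto simp: one_plus_def Field_def)
  have "(None, x) \<in> one_plus D" if "x \<in> insert None (Some ` Field D)" for x
    using that by (auto simp: one_plus_def)
  then show "insert None (Some ` Field D) \<subseteq> Field (one_plus D)" by (auto intro: FieldI2)
qed

text \<open>\<open>z\<close> is the zero of \<open>S\<close> and \<open>h\<close> sends the ordinal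
  \<open>b\<close> of \<open>S'\<close> to 1 + b. The comparisons of exponents work with these two
  in place of \<open>one_plus\<close>.\<close>

lemma one_plus_isoE:
  assumes iso: "(one_plus S', S) \<in> ordIso"
  obtains z h where "underS S z = {}" "Field S = insert z (h ` Field S')" "z \<notin> h ` Field S'"
    "inj_on h (Field S')"
    "\<And>a b. a \<in> Field S' \<Longrightarrow> b \<in> Field S' \<Longrightarrow> (h a, h b) \<in> S \<longleftrightarrow> (a, b) \<in> S'"
proof -
  obtain f where f: "iso (one_plus S') S f" using iso by (auto simp: ordIso_def)
  have bij: "bij_betw f (insert None (Some ` Field S')) (Field S)"
    and ord: "\<And>a b. a \<in> insert None (Some ` Field S') \<Longrightarrow> b \<in> insert None (Some ` Field S') \<Longrightarrow>
      (a, b) \<in> one_plus S' \<longleftrightarrow> (f a, f b) \<in> S"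
    using f unfolding iso_iff2 Field_one_plus by blast+
  have inj: "inj_on f (insert None (Some ` Field S'))" and
    im: "Field S = insert (f None) ((\<lambda>b. f (Some b)) ` Field S')"
    using bij by (auto simp: bij_betw_def image_image)
  have "underS S (f None) = {}"
  proof (rule ccontr)
    assume "underS S (f None) \<noteq> {}"
    then obtain w where w: "(w, f None) \<in> S" "w \<noteq> f None" by (auto simp: underS_def)
    then have "w \<in> Field S" by (intro FieldI1)
    then obtain b where b: "b \<in> Field S'" "w = f (Some b)" using im w(2) by auto
    then have "(Some b, None) \<in> one_plus S'" using ord[of "Some b" None] w(1) by auto
    then show False by (auto simp: one_plus_def)
  qed
  moreover have "f None \<notin> (\<lambda>b. f (Some b)) ` Field S'"
    using inj by (auto simp: inj_on_def)
  moreover have "inj_on (\<lambda>b. f (Some b)) (Field S')" using inj by (auto simp: inj_on_def)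
  moreover have "(f (Some a), f (Some b)) \<in> S \<longleftrightarrow> (a, b) \<in> S'"
    if "a \<in> Field S'" "b \<in> Field S'" for a b
    using ord[of "Some a" "Some b"] that by (auto simp: one_plus_def)
  ultimately show ?thesis using im that by blast
qed

text \<open>Every move strictly lowers the total number of positions left in the tuple, so the rank
  is bounded by a natural number.\<close>

lemma finite_natsum:
  assumes wo: "\<And>i. i \<in> I \<Longrightarrow> Well_order (r i)" and fin: "\<And>i. i \<in> I \<Longrightarrow> finite (Field (r i))"
    and I: "finite I" and S: "Well_order S" and ge: "rank_ge (natsum_rel r I) u S"
  shows "finite (Field S)"
proof -
  define N where "N v = (\<Sum>i \<in> I. card (below (r i) (v i)))" for v
  have "N v < N u" if vu: "(v, u) \<in> natsum_rel r I" for u v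
  proof -
    obtain l q where l: "l \<in> I" "q \<in> below (r l) (u l)" "v l = Some q"
      "\<And>i. i \<in> I \<Longrightarrow> le_opt (r i) (v i) (u i)"
      using vu by (rule natsum_relE) (rule that)
    have fb: "finite (below (r i) e)" if "i \<in> I" for i e
      using fin[OF that] below_subset_Field by (rule finite_subset[rotated])
    have "below (r l) (v l) \<subset> below (r l) (u l)"
      using le_opt_below_mono[OF wo[OF l(1)] l(4)[OF l(1)]] l(2,3) by (auto simp: underS_def)
    then have "card (below (r l) (v l)) < card (below (r l) (u l))"
      using fb[OF l(1)] by (intro psubset_card_mono)
    moreover have "card (below (r i) (v i)) \<le> card (below (r i) (u i))" if "i \<in> I" for i
      using le_opt_below_mono[OF wo[OF that] l(4)[OF that]] fb[OF that] by (intro card_mono)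
    ultimately show ?thesis
      unfolding N_def using I l(1) by (intro sum_strict_mono_ex1) auto
  qed
  then show ?thesis
    using rank_ge_card_bound[OF S, of "natsum_rel r I" N u None] ge by simp
qed

text \<open>The lower bound splits on entry 1. If it is infinite, so is entry 0 by the ordering of
  the exponents, and the embedding \<open>h\<close> of \<open>S'\<close> into \<open>S\<close> gives
  the full natural sum without any loss. If it is finite, so is the whole tail; then
  \<open>S'\<close> is strictly shorter than \<open>S\<close>, and the unit of difference pays for
  the reserve move in \<open>rank_ge_dec_rel\<close>.\<close>

lemma rank_is_dec_rel:
  fixes r :: "nat \<Rightarrow> 'a rel" and S :: "'b rel" and S' :: "'c rel" and E :: "'d rel"
  assumes n: "2 \<le> n" and wo: "\<And>i. i < n \<Longrightarrow> Well_order (r i)"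
    and mono: "\<And>i. Suc i < n \<Longrightarrow> (r (Suc i), r i) \<in> ordLeq"
    and ne: "\<And>i. i < n \<Longrightarrow> Field (r i) \<noteq> {}"
    and sumS: "natsum_is r {1..<n} S" and S': "Well_order S'" and iso: "(one_plus S', S) \<in> ordIso"
    and E: "Well_order E" and sumE: "natsum2_is (r 0) S' E"
  shows "rank_is (dec_rel n r) (\<lambda>_. None) E"
proof -
  have S: "Well_order S" and leS: "rank_le (natsum_rel r {1..<n}) (\<lambda>_. None) S"
    and geS: "rank_ge (natsum_rel r {1..<n}) (\<lambda>_. None) S"
    using sumS by (auto simp: natsum_is_def rank_is_def)
  have leE: "rank_le (natsum2_rel (r 0) S') (None, None) E"
    and geE: "rank_ge (natsum2_rel (r 0) S') (None, None) E"
    using sumE by (auto simp: natsum2_is_def rank_is_def)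
  obtain z h where z: "underS S z = {}" and F: "Field S = insert z (h ` Field S')"
    and zh: "z \<notin> h ` Field S'" and inj: "inj_on h (Field S')"
    and ord: "\<And>a b. a \<in> Field S' \<Longrightarrow> b \<in> Field S' \<Longrightarrow> (h a, h b) \<in> S \<longleftrightarrow> (a, b) \<in> S'"
    using one_plus_isoE[OF iso] by metis
  have "rank_le (dec_rel n r) (\<lambda>_. None) E"
  proof (rule rank_le_dec_rel_natsum[OF n wo ne S S' E z _ leE leS, where h = h])
    fix s w assume s: "le_opt S' s None" and w: "w \<in> below S (map_option h s)"
    show "w = z \<or> (\<exists>b \<in> below S' s. w = h b)"
    proof (cases "w = z")
      case False
      then obtain b where b: "b \<in> Field S'" "w = h b"
        using w below_subset_Field[of S "map_option h s"] F by auto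
      have "b \<in> below S' s"
        using w b s ord[OF b(1)] by (cases s) (auto simp: underS_def le_opt_def)
      then show ?thesis using b(2) by blast
    qed simp
  qed
  moreover have "rank_ge (dec_rel n r) (\<lambda>_. None) (iseg E None)"
  proof (rule rank_ge_dec_rel[OF wo E, where a = 0 and a' = 1])
    show "0 < n" "1 < n" "(0 :: nat) \<noteq> 1" "below (r 0) None \<noteq> {}" "below (r 1) None \<noteq> {}"
      using n ne[of 0] ne[of 1] by auto
    let ?top = "\<lambda>_ :: nat. None :: 'a option"
    show "(\<exists>i < n. \<exists>q \<in> below (r i) None.
          rank_ge (sdec_rel n r) (?top(i := Some q)) (iseg E None)) \<or>
        rank_ge (sdec_rel n r) ?top (iseg E None) \<and>
          infinite (below (r 0) None) \<and> infinite (below (r 1) None)"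
    proof (cases "finite (Field (r 1))")
      case False
      have "infinite (Field (r 0))"
        using False card_of_ordLeq_finite[OF card_of_mono2[OF mono[of 0]]] n by auto
      moreover have "rank_ge (sdec_rel n r) ?top (iseg E None)"
      proof (rule rank_ge_sdec_natsum[OF _ wo S E, where h = "map_option h" and s = None])
        fix s b assume b: "b \<in> below S' s"
        then have bF: "b \<in> Field S'" using below_subset_Field[of S' s] by blast
        have "h b \<in> below S (map_option h s)"
        proof (cases s)
          case None
          then show ?thesis using F bF by simp
        next
          case (Some c)
          then have "(b, c) \<in> S'" "b \<noteq> c" using b by (auto simp: underS_def)
          then show ?thesis
            using Some ord[of b c] inj by (auto simp: underS_def Field_def inj_on_def)
        qed
        then show "\<exists>w \<in> below S (map_option h s). map_option h (Some b) = Some w" by simp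
      qed (use n geE geS in \<open>simp_all add: fun_upd_idem\<close>)
      ultimately show ?thesis using False by simp
    next
      case True
      have fin: "finite (Field (r i))" if "i \<in> {1..<n}" for i
      proof -
        have "1 \<le> i" "i < n" using that by auto
        then show ?thesis
        proof (induction i rule: dec_induct)
          case base
          show ?case by (rule True)
        next
          case (step i)
          then show ?case using card_of_ordLeq_finite[OF card_of_mono2[OF mono[of i]]] by auto
        qed
      qed
      have finS: "finite (Field S)"
        by (rule finite_natsum[OF wo fin _ S geS]) auto
      have finS': "finite (Field S')" using finS F inj finite_imageD by auto
      have "\<not> (S, S') \<in> ordLeq"
      proof
        assume "(S, S') \<in> ordLeq"
        then obtain f where "inj_on f (Field S)" "f ` Field S \<subseteq> Field S'"
          using card_of_ordLeq[THEN iffD2, OF card_of_mono2, of S S'] by blast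
        then have "card (Field S) \<le> card (Field S')" using finS' by (intro card_inj_on_le)
        moreover have "card (Field S) = Suc (card (Field S'))"
          using F zh finS' card_image[OF inj] by simp
        ultimately show False by simp
      qed
      then have "(S', S) \<in> ordLess" using not_ordLeq_iff_ordLess[OF S' S] by blast
      then obtain w where w: "w \<in> Field S" and "(S', iseg S (Some w)) \<in> ordIso"
        unfolding ordLess_iff_ordIso_Restr[OF S S'] by (auto simp: iseg_def)
      then obtain g where "iso S' (iseg S (Some w)) g" by (auto simp: ordIso_def)
      then have g: "bij_betw g (Field S') (underS S w)"
        and gord: "\<And>a b. (a, b) \<in> S' \<Longrightarrow> (g a, g b) \<in> S"
        unfolding iso_iff2 Field_iseg[OF S] by (auto simp: iseg_def Field_def)
      \<comment> \<open>\<open>w\<close> marks the place of \<open>S'\<close> inside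
        \<open>S\<close>. One natural-sum move leads from the top to a tail \<open>u\<close> whose
        rank is still at least that of \<open>S'\<close>; an entry \<open>l\<close> lowered by it
        supplies the reserve move, and \<open>?h\<close> therefore starts at \<open>w\<close> rather
        than at the top of \<open>S\<close>.\<close>
      obtain u where u: "(u, ?top) \<in> natsum_rel r {1..<n}"
        "rank_ge (natsum_rel r {1..<n}) u (iseg S (Some w))"
        using rank_ge_isegD[OF S, where e = None, unfolded iseg_None below_None, OF geS w]
        by (elim exE conjE) (rule that)
      obtain l q where l: "l \<in> {1..<n}" "q \<in> below (r l) None" "u l = Some q"
        and out: "\<And>i. i \<notin> {1..<n} \<Longrightarrow> u i = None"
        using u(1) by (rule natsum_relE) blast
      have u0: "u 0 = None" using out[of 0] by simp
      let ?h = "\<lambda>s. Some (case s of None \<Rightarrow> w | Some b \<Rightarrow> g b)"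
      have "rank_ge (sdec_rel n r) u (iseg E None)"
      proof (rule rank_ge_sdec_natsum[OF _ wo S E, where h = ?h and s = None])
        fix s b assume b: "b \<in> below S' s"
        then have bF: "b \<in> Field S'" using below_subset_Field[of S' s] by blast
        have "g b \<in> below S (?h s)"
        proof (cases s)
          case None
          then show ?thesis using g bF by (auto simp: bij_betw_def)
        next
          case (Some c)
          then have "(b, c) \<in> S'" "b \<noteq> c" using b by (auto simp: underS_def)
          moreover from this have "g b \<noteq> g c"
            using g by (auto simp: bij_betw_def inj_on_def Field_def)
          ultimately show ?thesis using Some gord by (simp add: underS_def)
        qed
        then show "\<exists>v \<in> below S (?h s). ?h (Some b) = Some v" by simp
      qed (use n geE u(2) u0 in \<open>simp_all add: fun_upd_idem\<close>)
      then have "rank_ge (sdec_rel n r) (?top(l := Some q)) (iseg E None)"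
        by (rule rank_ge_sdec_mono[OF E]) (use l(3) in \<open>auto simp: below_subset_Field[THEN subsetD]\<close>)
      then show ?thesis using l(1,2) by auto
    qed
  qed
  ultimately show ?thesis using E by (simp add: rank_is_def)
qed

theorem mainTheorem8:
  fixes n :: nat and r :: "nat \<Rightarrow> 'a rel"
    and S :: "'b rel" and S' :: "'c rel" and E :: "'d rel"
  assumes "n \<ge> 2"
    and "\<forall>i < n. Well_order (r i)"
    and "\<forall>i. Suc i < n \<longrightarrow> (r (Suc i), r i) \<in> ordLeq"
    and "\<forall>i < n. Field (r i) \<noteq> {}"
    and "natsum_is r {1..<n} S"
    and "Well_order S'" and "(one_plus S', S) \<in> ordIso"
    and "Well_order E" and "natsum2_is (r 0) S' E"
  shows "width_is (prod_X n r) (prod_le n r) (omega_pow E)"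
  using assms by (intro width_prod_X rank_is_dec_rel[of n r S S' E]) auto

end
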